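(* Let $n=2^tm$ with $m$ odd, and let $x^n+1=(x+1)^{2^t}r_1^{2^t}\cdots r_l^{2^t}$ in $\mathbb{F}_2[x]$ with $r_1,\ldots,r_l$ monic prime self-reciprocal polynomials of even degree. (a) If $n$ is even, then \[ \mathcal{W}_{\mathcal{C}_2}(z)=\sum_{k=0}^nA^{\mathcal{C}_2}_kz^k=\left(1+\sum_{j=1}^{2^{t-1}}2^{3j-1}z^{2j}\right)\prod_{i=1}^lW_i(z),\quad W_i(z)=1+\sum_{j=1}^{2^t}\left(2^{\frac{3j\deg(r_i)}{2}}-2^{\frac{(3j-1)\deg(r_i)}{2}}\right)z^{j\deg(r_i)}, \] and \[ A^{\mathcal{C}_2}=2^{n+1+2^{t-1}}\prod_{i=1}^l\left(1+\sum_{j=1}^{2^t}\left(2^{\frac{j\deg(r_i)}{2}}-2^{\frac{(j-1)\deg(r_i)}{2}}\right)\right)-\frac{2^{3(2^{t-1}+1)}+6}{7}\prod_{i=1}^l\left(1+\sum_{j=1}^{2^t}\left(2^{\frac{3j\deg(r_i)}{2}}-2^{\frac{(3j-1)\deg(r_i)}{2}}\right)\right). \] (b) If $t=0$, i.e. $n$ is odd, then \[ \mathcal{W}_{\mathcal{C}_1}(z)=\sum_{k=0}^nA^{\mathcal{C}_1}_kz^k=\prod_{i=1}^{l}\left[1+\left(2^{3\deg(r_i)/2}-2^{\deg(r_i)}\right)z^{\deg(r_i)}\right] \] and \[ A^{\mathcal{C}_1}=2^{\frac{3n+1}{2}}-2\prod_{i=1}^{l}\left(1+2^{3\deg(r_i)/2}-2^{\deg(r_i)}\right).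 \]
   Context: $\mathrm{Tr}_n:\mathbb{F}_{2^n}\to\mathbb{F}_2$ is the absolute trace and $\mathrm{Tr}_{n/2}$ the absolute trace of $\mathbb{F}_{2^{n/2}}$. $\mathcal{C}_1$ is the set of functions $Q(x)=\mathrm{Tr}_n\big(\sum_{i=1}^{\lfloor (n-1)/2\rfloor}a_ix^{2^i+1}\big)$, $a_i\in\mathbb{F}_2$; for even $n$, $\mathcal{C}_2$ is the set of functions $Q(x)=\mathrm{Tr}_n\big(\sum_{i=1}^{n/2-1}a_ix^{2^i+1}\big)+\mathrm{Tr}_{n/2}(a_{n/2}x^{2^{n/2}+1})$, $a_i\in\mathbb{F}_2$ (both include the zero function). Let $\mathcal{A}=\{\mathrm{Tr}_n(bx)+c: b\in\mathbb{F}_{2^n},c\in\mathbb{F}_2\}$. Fix an ordering $\alpha_1,\dots,\alpha_{2^n}$ of $\mathbb{F}_{2^n}$. For $\mathcal{C}\in\{\mathcal{C}_1,\mathcal{C}_2\}$, $\bar R_{\mathcal{C}}$ is the binary code $\{(f(\alpha_1),\dots,f(\alpha_{2^n})): f=Q+\ell,\ Q\in\mathcal{C},\ \ell\in\mathcal{A}\}$ (a subcode of the second-order Reed–Muller code), with Hamming weight. For $0\le k\le n$, $A^{\mathcal{C}}_k$ is the number of codewords of $\bar R_{\mathcal{C}}$ of weight $2^{n-1}+2^{n-1-k/2}$ (this equals the number of codewords of weight $2^{n-1}-2^{n-1-k/2}$; $A^{\mathcal C}_k=0$ for odd $k$), and $A^{\mathcal{C}}$ is the number of codewords of weight exactly $2^{n-1}$.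 For $f\in\mathbb{F}_2[x]$ with $f(0)\ne0$, $f^*(x)=x^{\deg f}f(1/x)$; $f$ is self-reciprocal if $f^*=f$. A monic $f$ is prime self-reciprocal if either $f$ is irreducible and self-reciprocal, or $f=ugg^*$ with $g$ monic irreducible, $g^*$ not a constant multiple of $g$, $u$ a nonzero constant. *)

theory Defs
  imports
    Complex_Main
    "HOL-Library.Z2"
    "HOL-Library.Cardinality"
    "HOL-Computational_Algebra.Polynomial"
    "HOL-Computational_Algebra.Primes"
begin

text \<open>
  The field with \<open>2 ^ n\<close> elements is a type \<open>'a :: finite_field\<close> with \<open>CARD('a) = 2 ^ n\<close>.
  Its prime field \<open>{0, 1}\<close> plays the role of the field with two elements: traces, coefficients
  and codeword entries live there. Polynomials over the field with two elements, on the other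
  hand, are of type \<^typ>\<open>bit poly\<close>.
\<close>

definition F2 :: "'a :: field set" where
  "F2 = {0, 1}"

text \<open>
  The absolute trace of the field with \<open>2 ^ k\<close> elements. It is meaningful on the subfield
  \<open>{x. x ^ (2 ^ k) = x}\<close>, where its values lie in \<^const>\<open>F2\<close> (see \<open>abs_trace_in_F2\<close>).
\<close>

definition abs_trace :: "nat \<Rightarrow> 'a :: field \<Rightarrow> 'a" where
  "abs_trace k x = (\<Sum>i<k. x ^ (2 ^ i))"

definition C1 :: "nat \<Rightarrow> ('a :: field \<Rightarrow> 'a) set" where
  "C1 n = {Q. \<exists>a :: nat \<Rightarrow> 'a. range a \<subseteq> F2 \<and>
     Q = (\<lambda>x. abs_trace n (\<Sum>i = 1..(n - 1) div 2. a i * x ^ (2 ^ i + 1)))}"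

text \<open>
  Only for even \<open>n\<close>. The element \<open>x ^ (2 ^ (n div 2) + 1)\<close> is the norm of \<open>x\<close> to the subfield
  with \<open>2 ^ (n div 2)\<close> elements, so the second trace is taken on that subfield.
\<close>

definition C2 :: "nat \<Rightarrow> ('a :: field \<Rightarrow> 'a) set" where
  "C2 n = {Q. \<exists>a :: nat \<Rightarrow> 'a. range a \<subseteq> F2 \<and>
     Q = (\<lambda>x. abs_trace n (\<Sum>i = 1..n div 2 - 1. a i * x ^ (2 ^ i + 1))
            + abs_trace (n div 2) (a (n div 2) * x ^ (2 ^ (n div 2) + 1)))}"

definition affine_funs :: "nat \<Rightarrow> ('a :: field \<Rightarrow> 'a) set" where
  "affine_funs n = {\<l>. \<exists>b. \<exists>c \<in> F2. \<l> = (\<lambda>x. abs_trace n (b * x) + c)}"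

text \<open>The list \<open>as\<close> is an ordering of the field elements.\<close>

definition R_code :: "nat \<Rightarrow> 'a :: field list \<Rightarrow> ('a \<Rightarrow> 'a) set \<Rightarrow> 'a list set" where
  "R_code n as C = {map (\<lambda>x. Q x + \<l> x) as | Q \<l>. Q \<in> C \<and> \<l> \<in> affine_funs n}"

definition hamming_weight :: "'a :: zero list \<Rightarrow> nat" where
  "hamming_weight w = card {i. i < length w \<and> w ! i \<noteq> 0}"

text \<open>
  The exponent is real because \<open>k\<close> may be odd; the prescribed weight is then irrational and the
  number of such codewords is \<open>0\<close>.
\<close>

definition A_num :: "nat \<Rightarrow> 'a :: field list \<Rightarrow> ('a \<Rightarrow> 'a) set \<Rightarrow> nat \<Rightarrow> nat" where
  "A_num n as C k = card {w \<in> R_code n as C.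
     real (hamming_weight w) = 2 ^ (n - 1) + 2 powr (real n - 1 - real k / 2)}"

definition A_mid :: "nat \<Rightarrow> 'a :: field list \<Rightarrow> ('a \<Rightarrow> 'a) set \<Rightarrow> nat" where
  "A_mid n as C = card {w \<in> R_code n as C. hamming_weight w = 2 ^ (n - 1)}"

definition W_poly :: "nat \<Rightarrow> 'a :: field list \<Rightarrow> ('a \<Rightarrow> 'a) set \<Rightarrow> real poly" where
  "W_poly n as C = (\<Sum>k = 0..n. monom (real (A_num n as C k)) k)"

text \<open>
  For \<open>f\<close> with \<open>f(0) \<noteq> 0\<close>, \<^const>\<open>reflect_poly\<close> is the reciprocal \<open>x ^ deg f * f(1/x)\<close>
  (cf. \<open>poly_reflect_poly_nz\<close>).
\<close>

definition self_reciprocal :: "bit poly \<Rightarrow> bool" where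
  "self_reciprocal f \<longleftrightarrow> poly f 0 \<noteq> 0 \<and> reflect_poly f = f"

definition prime_self_reciprocal :: "bit poly \<Rightarrow> bool" where
  "prime_self_reciprocal f \<longleftrightarrow> lead_coeff f = 1 \<and>
     ((irreducible f \<and> self_reciprocal f) \<or>
      (\<exists>u g. u \<noteq> 0 \<and> irreducible g \<and> lead_coeff g = 1 \<and> poly g 0 \<noteq> 0 \<and>
         (\<nexists>c. reflect_poly g = smult c g) \<and> f = smult u (g * reflect_poly g)))"

lemma two_eq_0:
  assumes "CARD('a :: finite_field) = 2 ^ n"
  shows "(2 :: 'a) = 0"
proof -
  have "(\<Sum>x\<in>UNIV. x :: 'a) = (\<Sum>x\<in>UNIV. x + 1)"
    by (rule sum.reindex_bij_witness [of _ "\<lambda>x. x + 1" "\<lambda>x. x - 1"]) auto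
  hence "of_nat CARD('a) = (0 :: 'a)"
    by (simp add: sum.distrib)
  thus ?thesis
    using assms by simp
qed

lemma abs_trace_in_F2:
  fixes x :: "'a :: field"
  assumes "(2 :: 'a) = 0" and "x ^ (2 ^ k) = x"
  shows "abs_trace k x \<in> F2"
proof -
  have sq: "(u + v) ^ 2 = u ^ 2 + v ^ 2" for u v :: 'a
    by (simp add: power2_sum assms(1))
  have "(\<Sum>i<j. x ^ (2 ^ i)) ^ 2 = (\<Sum>i<j. x ^ (2 ^ Suc i))" for j
    by (induction j) (simp_all add: sq power_mult [symmetric] mult.commute)
  hence "abs_trace k x ^ 2 = (\<Sum>i<k. x ^ (2 ^ Suc i))"
    by (simp add: abs_trace_def)
  also have "\<dots> = (\<Sum>i<Suc k. x ^ (2 ^ i)) - x"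
    by (subst sum.lessThan_Suc_shift) simp
  also have "\<dots> = abs_trace k x"
    by (simp add: abs_trace_def assms(2))
  finally show ?thesis
    by (auto simp: F2_def power2_eq_square)
qed

lemma affine_funs_in_F2:
  fixes \<l> :: "'a :: finite_field \<Rightarrow> 'a"
  assumes "CARD('a) = 2 ^ n" and "\<l> \<in> affine_funs n"
  shows "\<l> x \<in> F2"
proof -
  obtain b c where "c \<in> F2" and \<l>: "\<l> x = abs_trace n (b * x) + c"
    using assms(2) by (auto simp: affine_funs_def)
  moreover have "abs_trace n (b * x) \<in> F2"
    by (rule abs_trace_in_F2)
      (use two_eq_0 [OF assms(1)] finite_field_power_card_eq_same [of "b * x"] assms(1) in simp_all)
  ultimately show ?thesis
    using two_eq_0 [OF assms(1)] by (auto simp: F2_def)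
qed

lemma C1_in_F2:
  fixes Q :: "'a :: finite_field \<Rightarrow> 'a"
  assumes "CARD('a) = 2 ^ n" and "Q \<in> C1 n"
  shows "Q x \<in> F2"
proof -
  have "y ^ (2 ^ n) = y" for y :: 'a
    using finite_field_power_card_eq_same [of y] assms(1) by simp
  thus ?thesis
    using assms(2) by (auto simp: C1_def intro!: abs_trace_in_F2 two_eq_0 [OF assms(1)])
qed

lemma C2_in_F2:
  fixes Q :: "'a :: finite_field \<Rightarrow> 'a"
  assumes "CARD('a) = 2 ^ n" and "even n" and "Q \<in> C2 n"
  shows "Q x \<in> F2"
proof -
  obtain h where h: "n = 2 * h"
    using assms(2) by (auto elim: evenE)
  obtain a where a: "range a \<subseteq> F2" and Q: "Q x =
      abs_trace n (\<Sum>i = 1..h - 1. a i * x ^ (2 ^ i + 1)) + abs_trace h (a h * x ^ (2 ^ h + 1))"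
    using assms(3) by (auto simp: C2_def h)
  note two = two_eq_0 [OF assms(1)]
  have frob: "y ^ (2 ^ n) = y" for y :: 'a
    using finite_field_power_card_eq_same [of y] assms(1) by simp
  have "(x ^ (2 ^ h + 1)) ^ (2 ^ h) = x ^ (2 ^ n) * x ^ (2 ^ h)"
    by (simp add: h power_add [symmetric] power_mult [symmetric] algebra_simps mult_2 mult_2_right)
  also have "\<dots> = x ^ (2 ^ h + 1)"
    by (simp add: frob)
  finally have norm: "(x ^ (2 ^ h + 1)) ^ (2 ^ h) = x ^ (2 ^ h + 1)" .
  have "a h ^ (2 ^ h) = a h"
  proof -
    have "a h = 0 \<or> a h = 1"
      using a by (auto simp: F2_def)
    thus ?thesis
      by auto
  qed
  hence "abs_trace h (a h * x ^ (2 ^ h + 1)) \<in> F2"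
    by (intro abs_trace_in_F2 two) (simp only: power_mult_distrib norm)
  moreover have "abs_trace n (\<Sum>i = 1..h - 1. a i * x ^ (2 ^ i + 1)) \<in> F2"
    by (intro abs_trace_in_F2 two frob)
  ultimately show ?thesis
    unfolding Q using two by (auto simp: F2_def)
qed

end

theory Submission
  imports
    Defs
    "HOL-Computational_Algebra.Polynomial_Factorial"
    "HOL-Library.FuncSet"
begin

text \<open>
  A form \<open>Q\<close> with coefficients \<open>a\<^sub>i\<close> polarises to \<open>Tr (y * L x)\<close>, where \<open>L\<close> is the square of the
  linearised polynomial obtained from the palindromic polynomial \<open>p = \<Sum> a\<^sub>i X\<^bsup>i-1\<^esup>\<close>,
  \<open>a\<^sub>i = a\<^bsub>n-i\<^esub>\<close>, by substituting the Frobenius map for \<open>X\<close>. The radical of \<open>Q\<close> therefore has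
  dimension \<open>deg (gcd p (X\<^sup>n + 1))\<close>, and if \<open>k\<close> is its codimension, squaring the character sums
  of \<open>Q\<close> plus affine functions shows that this coset contains \<open>2\<^sup>k\<close> words of weight
  \<open>2\<^bsup>n-1\<^esup> + 2\<^bsup>n-1-k/2\<^esup>\<close>, equally many of the complementary weight, and otherwise only words of
  weight \<open>2\<^bsup>n-1\<^esup>\<close>. It remains to count palindromic polynomials by their gcd with \<open>X\<^sup>n + 1\<close>. This gcd
  is a product of powers of the self-reciprocal factors, and the palindromic multiples of a
  self-reciprocal \<open>f\<close> of even degree correspond to shorter palindromes, so that there are
  \<open>2\<^bsup>(n - deg f) div 2\<^esup>\<close> of them. As this number is multiplicative over the factors, summation by
  parts turns the sum over all palindromes into the stated product. For even \<open>n\<close> the factor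
  \<open>X + 1\<close> enters through its square.
\<close>

section \<open>Polynomials over the field with two elements\<close>

text \<open>
  These two rules rewrite the field operations of \<^typ>\<open>bit\<close> to bitwise operations and so prevent the
  simplifier from using ring laws.
\<close>

declare add_bit_eq_xor [simp del] mult_bit_eq_and [simp del]

text \<open>Class \<open>field_gcd\<close> for the coefficients equips \<open>bit poly\<close> with
  gcds, so that coprimality and Bezout coefficients are at hand.\<close>

instantiation bit ::
  "{unique_euclidean_ring, normalization_euclidean_semiring, normalization_semidom_multiplicative}"
begin
definition [simp]: "normalize (x :: bit) = x"
definition [simp]: "unit_factor (x :: bit) = x"
definition [simp]: "euclidean_size (x :: bit) = (if x = 0 then 0 else 1 :: nat)"
definition [simp]: "division_segment (x :: bit) = 1"
instance
proof
  fix a b q r :: bit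
  show "b \<noteq> 0 \<Longrightarrow> euclidean_size r < euclidean_size b \<Longrightarrow> (q * b + r) div b = q"
    by (cases b; cases r) simp_all
qed (auto simp: dvd_field_iff)
end

instantiation bit :: euclidean_ring_gcd
begin
definition gcd_bit :: "bit \<Rightarrow> bit \<Rightarrow> bit" where
  "gcd_bit = Euclidean_Algorithm.gcd"
definition lcm_bit :: "bit \<Rightarrow> bit \<Rightarrow> bit" where
  "lcm_bit = Euclidean_Algorithm.lcm"
definition Gcd_bit :: "bit set \<Rightarrow> bit" where
 "Gcd_bit = Euclidean_Algorithm.Gcd"
definition Lcm_bit :: "bit set \<Rightarrow> bit" where
 "Lcm_bit = Euclidean_Algorithm.Lcm"
instance by standard (simp_all add: gcd_bit_def lcm_bit_def Gcd_bit_def Lcm_bit_def)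
end

instance bit :: field_gcd ..

section \<open>Arithmetic of \<open>bit poly\<close> in characteristic two\<close>

lemma bit_add_self [simp]: "b + b = (0 :: bit)"
  by (cases b) simp_all

lemma bit_poly_add_self [simp]: "p + p = (0 :: bit poly)"
  by (rule poly_eqI) (simp only: coeff_add bit_add_self coeff_0)

lemma bit_poly_add_eq_0_iff: "p + q = 0 \<longleftrightarrow> p = (q :: bit poly)"
  by (metis add_cancel_right_right add.assoc bit_poly_add_self)

lemma bit_poly_power2_add: "(p + q) ^ 2 = p ^ 2 + (q :: bit poly) ^ 2"
proof -
  have "(p + q) ^ 2 = p ^ 2 + q ^ 2 + (p * q + p * q)"
    by (simp only: power2_eq_square ring_distribs mult.commute [of q p] add_ac)
  thus ?thesis by simp
qed

lemma bit_poly_power_2_power_add: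
  "(p + q) ^ (2 ^ t) = p ^ (2 ^ t) + (q :: bit poly) ^ (2 ^ t)"
  by (induction t) (simp_all add: power_mult mult.commute [of 2] bit_poly_power2_add)

text \<open>Serves to take the \<open>2 ^ t\<close>-th root of the factorization of
  \<open>monom 1 n + 1\<close>, which leaves one of \<open>monom 1 m + 1\<close>.\<close>

lemma bit_poly_power_2_power_inject:
  assumes "p ^ (2 ^ t) = (q :: bit poly) ^ (2 ^ t)"
  shows "p = q"
proof -
  have "(p + q) ^ (2 ^ t) = 0"
    using assms by (simp add: bit_poly_power_2_power_add)
  thus ?thesis by (simp add: bit_poly_add_eq_0_iff)
qed

section \<open>Palindromic and self-reciprocal polynomials\<close>

text \<open>
  Here \<open>N\<close> is a formal length: leading zeros are allowed if they match zeros at the other end. Since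
  \<open>palindromes 0 = {0}\<close>, the truncated subtraction in \<open>mult_in_palindromes_iff\<close> is harmless.
\<close>

definition palindromes :: "nat \<Rightarrow> bit poly set" where
  "palindromes N = {p. (\<forall>i\<ge>N. coeff p i = 0) \<and> (\<forall>i<N. coeff p i = coeff p (N - 1 - i))}"

lemma zero_in_palindromes [simp]: "0 \<in> palindromes N"
  by (simp add: palindromes_def)

lemma palindromesD:
  assumes "p \<in> palindromes N"
  shows "i < N \<Longrightarrow> coeff p (N - 1 - i) = coeff p i" and "i \<ge> N \<Longrightarrow> coeff p i = 0"
  using assms by (simp_all only: palindromes_def mem_Collect_eq)

text \<open>PLACEHOLDER\<close>

lemma palindromes_iff_reflect:
  assumes "p \<noteq> 0"
  shows "p \<in> palindromes N \<longleftrightarrow>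
    degree p < N \<and> p = monom 1 (N - 1 - degree p) * reflect_poly p"
proof (cases "degree p < N")
  case True
  have "coeff (monom 1 (N - 1 - degree p) * reflect_poly p) i =
      (if i < N then coeff p (N - 1 - i) else 0)" for i
  proof -
    have "degree p - (i - (N - Suc (degree p))) = N - Suc i"
      if "N - Suc (degree p) \<le> i" "i - (N - Suc (degree p)) \<le> degree p" "i < N"
      using that True by linarith
    moreover have "coeff p (N - Suc i) = 0" if "i < N - Suc (degree p)"
      using that by (intro coeff_eq_0) linarith
    ultimately show ?thesis
      using True by (auto simp: coeff_monom_mult coeff_reflect_poly not_less)
  qed
  thus ?thesis
    using True by (auto simp: palindromes_def poly_eq_iff coeff_eq_0)
next
  case False
  hence "coeff p (degree p) \<noteq> 0" "degree p \<ge> N"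
    using assms by (auto simp del: bit_not_zero_iff)
  thus ?thesis by (auto simp: palindromes_def simp del: bit_not_zero_iff)
qed

lemma palindromes_degree: "p \<in> palindromes N \<Longrightarrow> p \<noteq> 0 \<Longrightarrow> degree p < N"
  by (simp add: palindromes_iff_reflect)

lemma self_reciprocal_nz: "self_reciprocal f \<Longrightarrow> f \<noteq> 0"
  by (auto simp: self_reciprocal_def)

lemma self_reciprocal_mult: "self_reciprocal f \<Longrightarrow> self_reciprocal g \<Longrightarrow> self_reciprocal (f * g)"
  by (simp add: self_reciprocal_def reflect_poly_mult)

lemma self_reciprocal_power: "self_reciprocal f \<Longrightarrow> self_reciprocal (f ^ k)"
  by (simp add: self_reciprocal_def reflect_poly_power)

lemma self_reciprocal_prod: "(\<And>i. i \<in> A \<Longrightarrow> self_reciprocal (f i)) \<Longrightarrow> self_reciprocal (prod f A)"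
  by (induction A rule: infinite_finite_induct)
    (auto simp: self_reciprocal_mult, simp_all add: self_reciprocal_def)

text \<open>Reflection is multiplicative and fixes \<open>f\<close>, so \<open>f\<close> cancels
  from the palindrome equation of \<open>palindromes_iff_reflect\<close>.\<close>

lemma mult_in_palindromes_iff:
  assumes f: "self_reciprocal f"
  shows "f * p \<in> palindromes N \<longleftrightarrow> p \<in> palindromes (N - degree f)"
proof (cases "p = 0")
  case False
  have nz: "f \<noteq> 0" using f by (rule self_reciprocal_nz)
  have refl: "reflect_poly f = f" using f by (simp add: self_reciprocal_def)
  have "f * p \<in> palindromes N \<longleftrightarrow> degree f + degree p < N \<and>
     f * p = monom 1 (N - 1 - (degree f + degree p)) * reflect_poly (f * p)"
    using nz False by (subst palindromes_iff_reflect) (auto simp: degree_mult_eq)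
  also have "monom 1 (N - 1 - (degree f + degree p)) * reflect_poly (f * p) =
      f * (monom 1 (N - degree f - 1 - degree p) * reflect_poly p)"
    by (simp add: reflect_poly_mult refl diff_diff_left add_ac mult_ac)
  finally show ?thesis
    using nz False by (subst palindromes_iff_reflect) (auto simp: less_diff_conv add.commute)
qed auto

text \<open>A nonzero palindrome is a monomial times its own reflection, and reflection preserves
  divisibility.\<close>

lemma reflect_dvd_palindrome:
  assumes "p \<in> palindromes N" "g dvd p"
  shows "reflect_poly g dvd p"
proof (cases "p = 0")
  case False
  obtain q where "p = g * q" using assms(2) by auto
  hence "reflect_poly g dvd reflect_poly p" by (simp add: reflect_poly_mult)
  thus ?thesis
    using assms(1) False by (metis palindromes_iff_reflect dvd_mult)
qed auto

text \<open>The first half of the coefficients, with the middle one if \<open>N\<close> is odd, is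
  free and determines the rest. The inverse reads position \<open>i\<close> off at
  \<open>min i (N - 1 - i)\<close>.\<close>

lemma bij_betw_palindromes:
  "bij_betw (\<lambda>p. {i. i < (N + 1) div 2 \<and> coeff p i \<noteq> 0}) (palindromes N) (Pow {..<(N + 1) div 2})"
proof (rule bij_betwI [where g = "\<lambda>S. Poly (map (\<lambda>i. of_bool (min i (N - 1 - i) \<in> S)) [0..<N])"])
  define P :: "nat set \<Rightarrow> bit poly"
    where "P = (\<lambda>S. Poly (map (\<lambda>i. of_bool (min i (N - 1 - i) \<in> S)) [0..<N]))"
  have coeff_P: "coeff (P S) i = (if i < N then of_bool (min i (N - 1 - i) \<in> S) else 0)" for S i
    by (simp add: P_def nth_default_def)
  show "(\<lambda>S. Poly (map (\<lambda>i. of_bool (min i (N - 1 - i) \<in> S)) [0..<N])) \<in>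
      Pow {..<(N + 1) div 2} \<rightarrow> palindromes N"
  proof
    fix S
    have "min (N - 1 - i) (N - 1 - (N - 1 - i)) = min i (N - 1 - i)" if "i < N" for i
      using that by linarith
    hence "P S \<in> palindromes N"
      by (auto simp: palindromes_def coeff_P)
    thus "Poly (map (\<lambda>i. of_bool (min i (N - 1 - i) \<in> S)) [0..<N]) \<in> palindromes N"
      by (simp add: P_def)
  qed
  show "Poly (map (\<lambda>i. of_bool (min i (N - 1 - i) \<in> {i. i < (N + 1) div 2 \<and> coeff p i \<noteq> 0})) [0..<N]) = p"
    if p: "p \<in> palindromes N" for p
  proof -
    have "of_bool (min i (N - 1 - i) < (N + 1) div 2 \<and> coeff p (min i (N - 1 - i)) \<noteq> 0) = coeff p i"
      if "i < N" for i
    proof -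
      have "min i (N - 1 - i) < (N + 1) div 2" using that by linarith
      moreover have "coeff p (min i (N - 1 - i)) = coeff p i"
        using palindromesD(1) [OF p that] by (simp add: min_def)
      ultimately show ?thesis by (cases "coeff p i") auto
    qed
    hence "P {i. i < (N + 1) div 2 \<and> coeff p i \<noteq> 0} = p"
      using palindromesD(2) [OF p] by (auto simp: poly_eq_iff coeff_P simp del: bit_not_zero_iff)
    thus ?thesis by (simp add: P_def)
  qed
  show "{i. i < (N + 1) div 2 \<and>
      coeff (Poly (map (\<lambda>i. of_bool (min i (N - 1 - i) \<in> S)) [0..<N])) i \<noteq> (0 :: bit)} = S"
    if "S \<in> Pow {..<(N + 1) div 2}" for S
  proof -
    have "min i (N - 1 - i) = i" "i < N" if "i < (N + 1) div 2" for i
      using that by linarith+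
    hence "{i. i < (N + 1) div 2 \<and> coeff (P S) i \<noteq> 0} = S"
      using that by (auto simp: coeff_P)
    thus ?thesis by (simp only: P_def)
  qed
qed auto

lemma card_palindromes: "card (palindromes N) = 2 ^ ((N + 1) div 2)"
  using bij_betw_same_card [OF bij_betw_palindromes] by (simp add: card_Pow)

lemma finite_palindromes [simp]: "finite (palindromes N)"
  using bij_betw_finite [OF bij_betw_palindromes] by simp

text \<open>By \<open>mult_in_palindromes_iff\<close> the cofactors of \<open>f\<close> are exactly
  the palindromes of formal length \<open>n - 1 - degree f\<close>.\<close>

lemma card_multiples_in_palindromes:
  assumes f: "self_reciprocal f" and deg: "degree f \<le> n" and n: "n > 0"
  shows "card {p \<in> palindromes (n - 1). f dvd p} = 2 ^ ((n - degree f) div 2)"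
proof -
  have nz: "f \<noteq> 0" using f by (rule self_reciprocal_nz)
  have "{p \<in> palindromes (n - 1). f dvd p} = (*) f ` palindromes (n - 1 - degree f)"
    by (auto simp: mult_in_palindromes_iff [OF f] elim!: dvdE)
  moreover have "inj_on ((*) f) (palindromes (n - 1 - degree f))"
    using nz by (auto simp: inj_on_def)
  ultimately have "card {p \<in> palindromes (n - 1). f dvd p} = 2 ^ ((n - 1 - degree f + 1) div 2)"
    by (simp only: card_image card_palindromes)
  \<comment> \<open>For \<open>degree f = n\<close> the subtraction truncates, but both exponents
    are then 0.\<close>
  also have "(n - 1 - degree f + 1) div 2 = (n - degree f) div 2"
    using deg n by (cases "degree f = n") auto
  finally show ?thesis .
qed

section \<open>Palindromes and the factor X + 1\<close>

lemma self_reciprocal_X_plus_1: "self_reciprocal [:1, 1:]"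
  by (simp add: self_reciprocal_def reflect_poly_pCons)

lemma X_plus_1_dvd_iff: "[:1, 1:] dvd p \<longleftrightarrow> poly p (1 :: bit) = 0"
  using poly_eq_0_iff_dvd [of p 1] by simp

text \<open>At 1 the mirrored coefficients cancel in pairs, as an even length has no middle
  position.\<close>

lemma X_plus_1_dvd_palindrome:
  assumes p: "p \<in> palindromes N" and N: "even N"
  shows "[:1, 1:] dvd p"
proof -
  obtain h where h: "N = h + h" using N by (metis evenE mult_2)
  have "poly p 1 = (\<Sum>i\<le>degree p. coeff p i)"
    by (simp only: poly_altdef power_one mult_1_right)
  also have "\<dots> = (\<Sum>i<N. coeff p i)"
  proof (cases "p = 0")
    case False
    hence "degree p < N" using p by (rule palindromes_degree [rotated])
    thus ?thesis by (intro sum.mono_neutral_left) (auto simp: coeff_eq_0)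
  qed simp
  also have "(\<Sum>i<N. coeff p i) = (\<Sum>i<h. coeff p i) + (\<Sum>i<h. coeff p (h + i))"
  proof -
    have "(\<Sum>i<h + k. coeff p i) = (\<Sum>i<h. coeff p i) + (\<Sum>i<k. coeff p (h + i))" for k
      by (induction k) (simp_all add: add.assoc)
    thus ?thesis unfolding h .
  qed
  also have "(\<Sum>i<h. coeff p (h + i)) = (\<Sum>i<h. coeff p (h - Suc i))"
  proof (rule sum.cong)
    fix i assume "i \<in> {..<h}"
    hence "h + i < N" "N - 1 - (h + i) = h - Suc i" using h by auto
    thus "coeff p (h + i) = coeff p (h - Suc i)"
      using palindromesD(1) [OF p, of "h + i"] by simp
  qed simp
  also have "\<dots> = (\<Sum>i<h. coeff p i)" by (rule sum.nat_diff_reindex)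
  finally show ?thesis by (simp add: X_plus_1_dvd_iff)
qed

section \<open>Prime self-reciprocal factors of palindromes\<close>

lemma normalize_bit_poly_eq_iff: "normalize p = normalize q \<longleftrightarrow> p = (q :: bit poly)"
proof -
  have "normalize p = p" for p :: "bit poly"
  proof -
    have "unit_factor p = 1" if "p \<noteq> 0"
      using that by (simp add: unit_factor_poly_def one_pCons) (metis bit_not_zero_iff leading_coeff_neq_0)
    thus ?thesis by (metis normalize_0 unit_factor_mult_normalize mult_1)
  qed
  thus ?thesis by simp
qed

lemma irreducible_coprimeI:
  assumes "irreducible p" "\<not> p dvd (q :: bit poly)"
  shows "coprime p q"
  using assms by (intro prime_elem_imp_coprime irreducible_imp_prime_elem)

text \<open>With nonzero constant terms, reflection is an involution that preserves degrees, so a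
  factorization of the reflection reflects back to one of \<open>g\<close>.\<close>

lemma irreducible_reflect_poly:
  assumes g: "irreducible g" and g0: "poly g 0 \<noteq> (0 :: bit)"
  shows "irreducible (reflect_poly g)"
proof (rule irreducibleI)
  have c0: "coeff g 0 \<noteq> 0" using g0 by (simp only: poly_0_coeff_0 not_False_eq_True)
  show "reflect_poly g \<noteq> 0" using g by auto
  show "\<not> is_unit (reflect_poly g)"
    using g c0 by (auto simp: is_unit_iff_degree irreducible_def simp del: bit_not_zero_iff)
  fix a b assume ab: "reflect_poly g = a * b"
  have "coeff a 0 * coeff b 0 \<noteq> 0"
    using g by (subst coeff_mult_0 [symmetric], subst ab [symmetric]) auto
  hence ab0: "coeff a 0 \<noteq> 0" "coeff b 0 \<noteq> 0" by auto
  have "g = reflect_poly a * reflect_poly b"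
    using c0 by (metis ab reflect_poly_mult reflect_poly_reflect_poly)
  hence "is_unit (reflect_poly a) \<or> is_unit (reflect_poly b)"
    using g irreducibleD by blast
  thus "is_unit a \<or> is_unit b"
  proof -
    have "is_unit p" if "is_unit (reflect_poly p)" "coeff p 0 \<noteq> 0" for p :: "bit poly"
      using that by (metis coeff_0 degree_reflect_poly_eq is_unit_iff_degree reflect_poly_eq_0_iff)
    thus ?thesis using ab0 \<open>is_unit (reflect_poly a) \<or> is_unit (reflect_poly b)\<close> by blast
  qed
qed

lemma prime_self_reciprocal_imp_self_reciprocal:
  assumes "prime_self_reciprocal r"
  shows "self_reciprocal r"
proof -
  consider "self_reciprocal r"
    | u g where "u \<noteq> (0 :: bit)" "poly g 0 \<noteq> 0" "r = smult u (g * reflect_poly g)" "irreducible g"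
    using assms by (auto simp: prime_self_reciprocal_def)
  thus ?thesis
  proof cases
    case 2
    hence "coeff g 0 \<noteq> 0" "g \<noteq> 0" by (auto simp: poly_0_coeff_0)
    thus ?thesis using 2
      by (simp add: self_reciprocal_def reflect_poly_mult reflect_poly_smult)
  qed
qed

text \<open>A palindrome is divisible by \<open>g\<close> iff it is divisible by the reflection of
  \<open>g\<close>. Hence the two irreducible factors of \<open>r\<close> divide it together or not
  at all, and \<open>r\<close> behaves like a prime towards palindromes.\<close>

lemma prime_self_reciprocal_coprime_palindrome:
  assumes r: "prime_self_reciprocal r" and p: "p \<in> palindromes N" and ndvd: "\<not> r dvd p"
  shows "coprime r p"
proof -
  consider "irreducible r"
    | u g where "u \<noteq> 0" "poly g 0 \<noteq> 0" "r = smult u (g * reflect_poly g)" "irreducible g"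
        "\<nexists>c. reflect_poly g = smult c g"
    using r by (auto simp: prime_self_reciprocal_def)
  thus ?thesis
  proof cases
    case 1
    thus ?thesis using ndvd by (rule irreducible_coprimeI)
  next
    case 2
    define h where "h = reflect_poly g"
    have h: "irreducible h" unfolding h_def using 2 by (intro irreducible_reflect_poly)
    have c0: "coeff g 0 \<noteq> 0" using 2 by (simp only: poly_0_coeff_0 not_False_eq_True)
    have r_eq: "r = g * h" using 2 by (simp add: h_def)
    have "h \<noteq> g" using 2 by (metis h_def smult_1_left)
    \<comment> \<open>Associated polynomials over \<open>bit\<close> are equal, so distinct
      irreducible ones are coprime.\<close>
    hence "coprime g h"
      using 2 h irreducible_coprimeI [of g h] irreducible_imp_prime_elem
      by (metis normalize_bit_poly_eq_iff associated_iff_dvd irreducibleD' irreducible_not_unit)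
    moreover have "g dvd p \<longleftrightarrow> h dvd p"
    proof
      show "g dvd p \<Longrightarrow> h dvd p" using reflect_dvd_palindrome [OF p] by (simp add: h_def)
      have "reflect_poly h = g" using c0 by (simp add: h_def)
      thus "h dvd p \<Longrightarrow> g dvd p" using reflect_dvd_palindrome [OF p] by metis
    qed
    ultimately have "\<not> g dvd p" "\<not> h dvd p"
      using ndvd unfolding r_eq by (auto intro: divides_mult)
    thus ?thesis
      unfolding r_eq using 2 h irreducible_coprimeI by (simp add: irreducible_coprimeI)
  qed
qed

text \<open>If X + 1 divides a palindrome of odd length, the quotient is a palindrome of even length
  and is divisible by X + 1 again.\<close>

lemma X_plus_1_square_coprime_palindrome:
  assumes p: "p \<in> palindromes N" and N: "odd N" and ndvd: "\<not> [:1, 1:] ^ 2 dvd p"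
  shows "coprime ([:1, 1 :: bit:] ^ 2) p"
proof (rule ccontr)
  assume "\<not> coprime ([:1, 1 :: bit:] ^ 2) p"
  hence "\<not> coprime [:1, 1 :: bit:] p" by simp
  moreover have "irreducible [:1, 1 :: bit:]" 
  proof (rule irreducibleI)
    fix a b assume ab: "[:1, 1 :: bit:] = a * b"
    hence "a \<noteq> 0" "b \<noteq> 0" by auto
    moreover have "degree [:1, 1 :: bit:] = degree a + degree b"
      unfolding ab using calculation by (rule degree_mult_eq)
    ultimately show "is_unit a \<or> is_unit b"
      by (auto simp: is_unit_iff_degree)
  qed (auto simp: is_unit_iff_degree)
  ultimately have "[:1, 1:] dvd p" using irreducible_coprimeI by blast
  then obtain q where q: "p = [:1, 1:] * q" by auto
  hence "q \<in> palindromes (N - 1)"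
    using p mult_in_palindromes_iff [OF self_reciprocal_X_plus_1] by simp
  hence "[:1, 1:] dvd q" using N by (intro X_plus_1_dvd_palindrome) auto
  thus False using ndvd unfolding q power2_eq_square by (meson mult_dvd_mono dvd_refl)
qed

section \<open>Counting palindromes by divisibility\<close>

text \<open>Each weight is the sum of its increments up to the level. Expanding the product and
  exchanging sums leaves, for every \<open>f\<close>, the number of \<open>s\<close> whose levels
  are all at least \<open>f\<close>, and this number factors over \<open>I\<close> by
  hypothesis.\<close>

lemma sum_prod_levels:
  fixes e :: "'s \<Rightarrow> 'i \<Rightarrow> nat" and w :: "'i \<Rightarrow> nat \<Rightarrow> 'c :: comm_ring_1"
  assumes fin: "finite S" "finite I"
    and le: "\<And>s i. s \<in> S \<Longrightarrow> i \<in> I \<Longrightarrow> e s i \<le> E i"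
    and count: "\<And>f. f \<in> (\<Pi>\<^sub>E i\<in>I. {..E i}) \<Longrightarrow>
        card {s \<in> S. \<forall>i\<in>I. f i \<le> e s i} = (\<Prod>i\<in>I. M i (f i))"
  shows "(\<Sum>s\<in>S. \<Prod>i\<in>I. w i (e s i)) =
    (\<Prod>i\<in>I. \<Sum>f\<le>E i. (w i f - (if f = 0 then 0 else w i (f - 1))) * of_nat (M i f))"
proof -
  define v where "v = (\<lambda>i f. w i f - (if f = 0 then 0 else w i (f - 1)))"
  have w: "w i k = (\<Sum>f\<le>k. v i f)" for i k
    by (induction k) (simp_all add: v_def)
  have "(\<Sum>s\<in>S. \<Prod>i\<in>I. w i (e s i)) =
      (\<Sum>s\<in>S. \<Prod>i\<in>I. \<Sum>f\<le>E i. v i f * of_bool (f \<le> e s i))"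
  proof (intro sum.cong prod.cong refl)
    fix s i assume "s \<in> S" "i \<in> I"
    hence "e s i \<le> E i" by (rule le)
    thus "w i (e s i) = (\<Sum>f\<le>E i. v i f * of_bool (f \<le> e s i))"
      unfolding w by (intro sum.mono_neutral_cong_left) auto
  qed
  also have "\<dots> = (\<Sum>s\<in>S. \<Sum>f\<in>(\<Pi>\<^sub>E i\<in>I. {..E i}).
      (\<Prod>i\<in>I. v i (f i)) * of_bool (\<forall>i\<in>I. f i \<le> e s i))"
  proof -
    have "(\<Prod>i\<in>I. of_bool (f i \<le> e s i)) = (of_bool (\<forall>i\<in>I. f i \<le> e s i) :: 'c)" for f s
      using fin(2) by (induction I rule: finite_induct) auto
    thus ?thesis by (simp only: prod_sum_PiE [OF fin(2)] prod.distrib finite_atMost)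
  qed
  also have "\<dots> = (\<Sum>f\<in>(\<Pi>\<^sub>E i\<in>I. {..E i}). \<Sum>s\<in>S.
      (\<Prod>i\<in>I. v i (f i)) * of_bool (\<forall>i\<in>I. f i \<le> e s i))"
    by (rule sum.swap)
  also have "\<dots> = (\<Sum>f\<in>(\<Pi>\<^sub>E i\<in>I. {..E i}). \<Prod>i\<in>I. v i (f i) * of_nat (M i (f i)))"
  proof (intro sum.cong refl)
    fix f assume f: "f \<in> (\<Pi>\<^sub>E i\<in>I. {..E i})"
    have "(\<Sum>s\<in>S. of_bool (\<forall>i\<in>I. f i \<le> e s i)) =
        (of_nat (card {s \<in> S. \<forall>i\<in>I. f i \<le> e s i}) :: 'c)"
      using fin by (simp add: sum_of_bool_eq Int_def)
    thus "(\<Sum>s\<in>S. (\<Prod>i\<in>I. v i (f i)) * of_bool (\<forall>i\<in>I. f i \<le> e s i)) =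
        (\<Prod>i\<in>I. v i (f i) * of_nat (M i (f i)))"
      by (simp add: count [OF f] prod.distrib flip: sum_distrib_left)
  qed
  also have "\<dots> = (\<Prod>i\<in>I. \<Sum>f\<le>E i. v i f * of_nat (M i f))"
    using fin by (simp add: prod_sum_PiE)
  finally show ?thesis by (simp add: v_def)
qed

text \<open>Reindexing by \<open>j = E - f\<close> and summation by parts move the differences from
  the weights \<open>w\<close> to the counts \<open>m\<close>.\<close>

lemma sum_levels_Abel:
  fixes w :: "nat \<Rightarrow> 'c :: comm_ring_1"
  shows "(\<Sum>f\<le>E. (w (E - f) - (if f = 0 then 0 else w (E - (f - 1)))) * m (E - f)) =
    w 0 * m 0 + (\<Sum>j=1..E. w j * (m j - m (j - 1)))"
proof -
  have "(\<Sum>f\<le>E. (w (E - f) - (if f = 0 then 0 else w (E - (f - 1)))) * m (E - f)) =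
      (\<Sum>j\<le>E. (w j - (if j = E then 0 else w (Suc j))) * m j)"
    by (rule sum.reindex_bij_witness [of _ "\<lambda>j. E - j" "\<lambda>j. E - j"])
      (auto simp: Suc_diff_le)
  also have "\<dots> = (\<Sum>j\<le>E. w j * m j) - (\<Sum>j<E. w (Suc j) * m j)"
  proof -
    have "(\<Sum>j\<le>E. (if j = E then 0 else w (Suc j)) * m j) = (\<Sum>j<E. w (Suc j) * m j)"
      by (rule sum.mono_neutral_cong_right) auto
    thus ?thesis by (simp add: left_diff_distrib sum_subtractf)
  qed
  also have "\<dots> = w 0 * m 0 + (\<Sum>j<E. w (Suc j) * (m (Suc j) - m j))"
    by (simp add: right_diff_distrib sum_subtractf sum.atMost_shift)
  also have "(\<Sum>j<E. w (Suc j) * (m (Suc j) - m j)) = (\<Sum>j=1..E. w j * (m j - m (j - 1)))"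
    by (rule sum.reindex_bij_witness [of _ "\<lambda>j. j - 1" Suc]) auto
  finally show ?thesis .
qed

lemma prod_dvd_iff_pairwise_coprime:
  fixes f :: "'i \<Rightarrow> 'r :: semiring_gcd"
  assumes "finite A" "\<And>i j. i \<in> A \<Longrightarrow> j \<in> A \<Longrightarrow> i \<noteq> j \<Longrightarrow> coprime (f i) (f j)"
  shows "prod f A dvd x \<longleftrightarrow> (\<forall>i\<in>A. f i dvd x)"
  using assms
proof (induction A rule: finite_induct)
  case (insert i A)
  hence "coprime (f i) (prod f A)" by (intro prod_coprime_right) auto
  moreover have "prod f A dvd x \<longleftrightarrow> (\<forall>i\<in>A. f i dvd x)" using insert by simp
  ultimately show ?case
    using insert(1,2) by (auto intro: divides_mult dvd_mult_left dvd_mult_right)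
qed simp

section \<open>Factorizations of X^n + 1 suited to palindromes\<close>

text \<open>
  For even \<open>n\<close> this is used with \<open>P = 1\<close> and \<open>(X + 1)\<^sup>2\<close> among the \<open>R i\<close>, as \<open>X + 1\<close> divides a palindrome
  of odd length to an even power; for odd \<open>n\<close> with \<open>P = X + 1\<close>, which divides all palindromes of even
  length.
\<close>

locale palindromic_factorization =
  fixes n :: nat and P :: "bit poly" and I :: "nat set" and R :: "nat \<Rightarrow> bit poly"
    and E :: "nat \<Rightarrow> nat"
  assumes n_pos: "n > 0" and fin: "finite I"
    and fact: "monom 1 n + 1 = P * (\<Prod>i\<in>I. R i ^ E i)"
    and self_rec: "\<And>i. i \<in> I \<Longrightarrow> self_reciprocal (R i)"
    and even_deg: "\<And>i. i \<in> I \<Longrightarrow> even (degree (R i))"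
    and coprime_R: "\<And>i j. i \<in> I \<Longrightarrow> j \<in> I \<Longrightarrow> i \<noteq> j \<Longrightarrow> coprime (R i) (R j)"
    and coprime_P: "\<And>i. i \<in> I \<Longrightarrow> coprime P (R i)"
    and degree_P: "degree P \<le> 1"
    and P_dvd: "\<And>p. p \<in> palindromes (n - 1) \<Longrightarrow> P dvd p"
    and coprime_palindrome: "\<And>i N p. i \<in> I \<Longrightarrow> p \<in> palindromes N \<Longrightarrow> even N = even (n - 1) \<Longrightarrow>
      \<not> R i dvd p \<Longrightarrow> coprime (R i) p"
begin

text \<open>The exponent of \<open>R i\<close> in the gcd of \<open>p\<close> with
  \<open>monom 1 n + 1\<close>. The bound \<open>E i\<close> keeps the set finite, also for
  \<open>p = 0\<close>, where the level is \<open>E i\<close>.\<close>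

definition level :: "bit poly \<Rightarrow> nat \<Rightarrow> nat" where
  "level p i = Max {e. e \<le> E i \<and> R i ^ e dvd p}"

lemma level_props: "level p i \<le> E i" "R i ^ level p i dvd p"
proof -
  have "level p i \<in> {e. e \<le> E i \<and> R i ^ e dvd p}"
    unfolding level_def by (rule Max_in) (auto intro!: exI [of _ 0])
  thus "level p i \<le> E i" "R i ^ level p i dvd p" by auto
qed

lemma power_dvd_iff_level: "f \<le> E i \<Longrightarrow> R i ^ f dvd p \<longleftrightarrow> f \<le> level p i"
proof
  assume "f \<le> E i" "R i ^ f dvd p"
  thus "f \<le> level p i" unfolding level_def by (intro Max_ge) auto
next
  assume "f \<le> level p i"
  thus "R i ^ f dvd p" using level_props(2) by (meson dvd_trans le_imp_power_dvd)
qed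

lemma R_nz: "i \<in> I \<Longrightarrow> R i \<noteq> 0"
  using self_rec self_reciprocal_nz by blast

lemma P_nz: "P \<noteq> 0"
proof
  assume "P = 0"
  hence "monom 1 n + 1 = (0 :: bit poly)" using fact by simp
  hence "coeff (monom 1 n + 1 :: bit poly) n = 0" by simp
  thus False using n_pos by (simp add: coeff_1)
qed

lemma degree_prod_R: "degree (\<Prod>i\<in>I. R i ^ f i) = (\<Sum>i\<in>I. f i * degree (R i))"
  by (subst degree_prod_eq_sum_degree) (auto simp: R_nz degree_power_eq)

lemma degree_fact: "n = degree P + (\<Sum>i\<in>I. E i * degree (R i))"
proof -
  have "degree (monom 1 n + 1 :: bit poly) = n"
    using n_pos by (subst degree_add_eq_left) (auto simp: degree_monom_eq)
  moreover have "degree (P * (\<Prod>i\<in>I. R i ^ E i)) = degree P + (\<Sum>i\<in>I. E i * degree (R i))"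
    using P_nz R_nz fin by (subst degree_mult_eq) (auto simp: degree_prod_R)
  ultimately show ?thesis by (simp add: fact)
qed

lemma prod_R_dvd_iff: "(\<Prod>i\<in>I. R i ^ f i) dvd p \<longleftrightarrow> (\<forall>i\<in>I. R i ^ f i dvd p)"
  using coprime_R by (intro prod_dvd_iff_pairwise_coprime fin) auto

text \<open>The condition says that the self-reciprocal product of the \<open>R i ^ f i\<close>
  divides \<open>p\<close>, so \<open>card_multiples_in_palindromes\<close> applies.\<close>

lemma card_level_ge:
  assumes f: "\<And>i. i \<in> I \<Longrightarrow> f i \<le> E i"
  shows "card {p \<in> palindromes (n - 1). \<forall>i\<in>I. f i \<le> level p i} =
    (\<Prod>i\<in>I. 2 ^ ((E i - f i) * degree (R i) div 2))"
proof -
  define F where "F = (\<Prod>i\<in>I. R i ^ f i)"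
  have deg_F: "degree F + (\<Sum>i\<in>I. (E i - f i) * degree (R i)) = (\<Sum>i\<in>I. E i * degree (R i))"
    unfolding F_def degree_prod_R sum.distrib [symmetric]
    by (intro sum.cong) (auto simp: f simp flip: distrib_right)
  have half: "(\<Sum>i\<in>I. (E i - f i) * degree (R i)) = 2 * (\<Sum>i\<in>I. (E i - f i) * degree (R i) div 2)"
    unfolding sum_distrib_left by (intro sum.cong) (auto simp: even_deg)
  have "{p \<in> palindromes (n - 1). \<forall>i\<in>I. f i \<le> level p i} = {p \<in> palindromes (n - 1). F dvd p}"
    unfolding F_def prod_R_dvd_iff by (auto simp: power_dvd_iff_level f)
  moreover have "self_reciprocal F"
    unfolding F_def by (intro self_reciprocal_prod self_reciprocal_power self_rec)
  moreover have "degree F \<le> n" using deg_F degree_fact by linarith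
  ultimately have "card {p \<in> palindromes (n - 1). \<forall>i\<in>I. f i \<le> level p i} = 2 ^ ((n - degree F) div 2)"
    using n_pos by (simp only: card_multiples_in_palindromes)
  \<comment> \<open>All summands of \<open>n - degree F\<close> except \<open>degree P\<close> are
    even, and \<open>degree P\<close> is at most 1; halving therefore drops it and is additive over
    \<open>I\<close>.\<close>
  also have "(n - degree F) div 2 = (\<Sum>i\<in>I. (E i - f i) * degree (R i) div 2)"
    using deg_F half degree_fact degree_P by linarith
  finally show ?thesis by (simp add: power_sum)
qed

text \<open>The weights depend on \<open>E i - level p i\<close> because this is the share of
  \<open>R i\<close> in the rank of the form belonging to \<open>p\<close>.\<close>

lemma sum_prod_palindromes:
  fixes w :: "nat \<Rightarrow> nat \<Rightarrow> 'c :: comm_ring_1"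
  shows "(\<Sum>p\<in>palindromes (n - 1). \<Prod>i\<in>I. w i (E i - level p i)) =
    (\<Prod>i\<in>I. w i 0 + (\<Sum>j=1..E i. w i j *
      (2 ^ (j * degree (R i) div 2) - 2 ^ ((j - 1) * degree (R i) div 2))))"
proof -
  have "(\<Sum>p\<in>palindromes (n - 1). \<Prod>i\<in>I. w i (E i - level p i)) =
    (\<Prod>i\<in>I. \<Sum>f\<le>E i. (w i (E i - f) - (if f = 0 then 0 else w i (E i - (f - 1)))) *
      of_nat (2 ^ ((E i - f) * degree (R i) div 2)))"
  proof (rule sum_prod_levels [where w = "\<lambda>i f. w i (E i - f)"])
    fix f assume "f \<in> (\<Pi>\<^sub>E i\<in>I. {..E i})"
    thus "card {p \<in> palindromes (n - 1). \<forall>i\<in>I. f i \<le> level p i} =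
        (\<Prod>i\<in>I. 2 ^ ((E i - f i) * degree (R i) div 2))"
      by (intro card_level_ge) auto
  qed (simp_all add: fin level_props)
  also have "\<dots> = (\<Prod>i\<in>I. w i 0 * of_nat (2 ^ (0 * degree (R i) div 2)) + (\<Sum>j=1..E i. w i j *
      (of_nat (2 ^ (j * degree (R i) div 2)) - of_nat (2 ^ ((j - 1) * degree (R i) div 2)))))"
    by (intro prod.cong refl)
      (rule sum_levels_Abel [where m = "\<lambda>j. of_nat (2 ^ (j * degree (R _) div 2))"])
  finally show ?thesis by simp
qed

text \<open>\<open>G\<close> is the gcd of \<open>p\<close> and \<open>monom 1 n + 1\<close>, namely
  \<open>P\<close> times the product of the \<open>R i ^ level p i\<close>; \<open>C\<close> and
  \<open>H\<close> are the cofactors.\<close>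

lemma palindrome_gcd_decomposition:
  assumes p: "p \<in> palindromes (n - 1)"
  obtains G C H where "p = G * C" "monom 1 n + 1 = G * H" "coprime C H"
    "degree G + (\<Sum>i\<in>I. (E i - level p i) * degree (R i)) = n"
proof -
  define F where "F = (\<Prod>i\<in>I. R i ^ level p i)"
  define H where "H = (\<Prod>i\<in>I. R i ^ (E i - level p i))"
  have FH: "F * H = (\<Prod>i\<in>I. R i ^ E i)"
    by (simp add: F_def H_def level_props flip: prod.distrib power_add)
  have "coprime P F"
    unfolding F_def using coprime_P by (intro prod_coprime_right) auto
  moreover have "F dvd p"
    unfolding F_def prod_R_dvd_iff using level_props by blast
  ultimately have "P * F dvd p"
    using P_dvd [OF p] by (intro divides_mult)
  then obtain C where C: "p = P * F * C" by auto
  \<comment> \<open>Only factors whose level is below \<open>E i\<close> matter. For these, dividing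
    \<open>p\<close> by \<open>R i ^ level p i\<close> leaves a palindrome that \<open>R i\<close>
    does not divide and that is therefore coprime to \<open>R i\<close>.\<close>
  have "coprime C (R i ^ (E i - level p i))" if i: "i \<in> I" for i
  proof (cases "level p i < E i")
    case True
    obtain B where B: "p = R i ^ level p i * B"
      using level_props(2) dvdE by blast
    have "\<not> R i dvd B"
    proof
      assume "R i dvd B"
      hence "R i ^ Suc (level p i) dvd p"
        by (subst B) (simp add: mult.commute mult_dvd_mono)
      thus False using True power_dvd_iff_level [of "Suc (level p i)" i p] by simp
    qed
    moreover have "B \<in> palindromes (n - 1 - level p i * degree (R i))"
      using p mult_in_palindromes_iff [OF self_reciprocal_power [OF self_rec [OF i]]] B
      by (metis R_nz degree_power_eq i)
    moreover have "even (n - 1 - level p i * degree (R i)) = even (n - 1)"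
    proof (cases "degree (R i) = 0")
      case False
      \<comment> \<open>One more factor \<open>R i\<close> still fits into degree \<open>n\<close>,
        so the length does not truncate and the even degree of \<open>R i\<close> preserves its
        parity.\<close>
      have "(level p i + 1) * degree (R i) \<le> E i * degree (R i)"
        using True by (intro mult_right_mono) auto
      also have "\<dots> \<le> (\<Sum>i\<in>I. E i * degree (R i))"
        using fin i by (intro member_le_sum) auto
      also have "\<dots> \<le> n" using degree_fact by linarith
      finally have "level p i * degree (R i) \<le> n - 1"
        using False by (simp add: algebra_simps)
      moreover have "even (level p i * degree (R i))" using even_deg i by simp
      ultimately show ?thesis by (metis even_diff_nat even_add linorder_not_less)
    qed simp
    ultimately have "coprime (R i) B" using coprime_palindrome i by blast
    moreover have "C dvd B"
    proof -
      have "R i ^ level p i dvd F" unfolding F_def using fin i by (intro dvd_prodI)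
      hence "R i ^ level p i * C dvd P * F * C"
        by (intro mult_dvd_mono) auto
      hence "R i ^ level p i * C dvd R i ^ level p i * B"
        using B C by metis
      thus ?thesis using R_nz [OF i] by simp
    qed
    ultimately have "coprime (R i) C" by (meson coprime_divisors dvd_refl)
    thus ?thesis by (simp add: coprime_commute)
  qed simp
  hence "coprime C H" unfolding H_def by (intro prod_coprime_right)
  moreover have "degree (P * F) + (\<Sum>i\<in>I. (E i - level p i) * degree (R i)) = n"
  proof -
    have "F * H \<noteq> 0" using R_nz fin by (simp add: F_def H_def)
    hence "degree (P * F) + degree H = degree (P * (F * H))"
      using P_nz by (simp add: degree_mult_eq)
    thus ?thesis
      using P_nz R_nz fin degree_fact unfolding FH by (simp add: degree_mult_eq degree_prod_R H_def)
  qed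
  moreover have "monom 1 n + 1 = P * F * H"
    by (simp add: fact mult.assoc FH)
  ultimately show ?thesis using that C by blast
qed

end

section \<open>Frobenius action and quadratic forms\<close>

locale binary_field =
  fixes n :: nat and field :: "'a :: finite_field itself"
  assumes card_field: "CARD('a) = 2 ^ n"
begin

lemma two [simp]: "(2 :: 'a) = 0"
  by (rule two_eq_0 [OF card_field])

lemma add_self [simp]: "x + x = (0 :: 'a)"
  by (simp flip: mult_2)

lemma add_add_self [simp]: "x + y + y = (x :: 'a)"
  by (simp add: add.assoc)

lemma frob_n [simp]: "x ^ (2 ^ n) = (x :: 'a)"
  using finite_field_power_card_eq_same [of x] by (simp add: card_field)

lemma n_pos: "n > 0"
proof -
  have "card {0, 1 :: 'a} \<le> CARD('a)" by (rule card_mono) auto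
  thus ?thesis by (cases n) (auto simp: card_field)
qed

lemma square_add: "(x + y) ^ 2 = x ^ 2 + (y :: 'a) ^ 2"
  by (simp add: power2_sum)

lemma frob_add: "(x + y) ^ (2 ^ i) = x ^ (2 ^ i) + (y :: 'a) ^ (2 ^ i)"
  by (induction i) (simp_all add: power_mult square_add mult.commute [of 2])

lemma frob_sum: "(\<Sum>j\<in>J. f j) ^ (2 ^ i) = (\<Sum>j\<in>J. f j ^ (2 ^ i) :: 'a)"
  by (induction J rule: infinite_finite_induct) (simp_all add: frob_add)

lemma frob_frob: "((x :: 'a) ^ (2 ^ i)) ^ (2 ^ j) = x ^ (2 ^ (i + j))"
  by (simp add: power_add flip: power_mult)

section \<open>The action of \<open>bit poly\<close> through the Frobenius map\<close>

lemma of_bit_add: "of_bit (a + b) = (of_bit a + of_bit b :: 'a)"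
  by (cases a; cases b) auto

lemma of_bit_eq_0_iff: "of_bit b = (0 :: 'a) \<longleftrightarrow> b = 0"
  by (cases b) auto

text \<open>This turns \<open>'a\<close> into a module over \<open>bit poly\<close> in which X acts
  as squaring.\<close>

definition act :: "bit poly \<Rightarrow> 'a \<Rightarrow> 'a" where
  "act p x = (\<Sum>i\<le>degree p. of_bit (coeff p i) * x ^ (2 ^ i))"

lemma act_eq_sum_lessThan:
  assumes "\<And>i. i \<ge> N \<Longrightarrow> coeff p i = 0"
  shows "act p x = (\<Sum>i<N. of_bit (coeff p i) * x ^ (2 ^ i))"
  unfolding act_def
proof (rule sum.mono_neutral_cong)
  fix i assume "i \<in> {..degree p} - {..<N}"
  thus "of_bit (coeff p i) * x ^ 2 ^ i = 0" using assms by simp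
next
  fix i assume "i \<in> {..<N} - {..degree p}"
  thus "of_bit (coeff p i) * x ^ 2 ^ i = 0" by (simp add: coeff_eq_0)
qed auto

lemma act_0 [simp]: "act 0 x = 0"
  by (simp add: act_def)

text \<open>The Horner scheme: squaring fixes the coefficients 0 and 1 and raises each Frobenius
  exponent by one.\<close>

lemma act_pCons: "act (pCons a p) x = of_bit a * x + act p x ^ 2"
proof -
  have "act (pCons a p) x = (\<Sum>i<Suc (Suc (degree p)). of_bit (coeff (pCons a p) i) * x ^ (2 ^ i))"
    by (rule act_eq_sum_lessThan) (auto simp: coeff_pCons coeff_eq_0 split: nat.split)
  also have "\<dots> = of_bit a * x + (\<Sum>i\<le>degree p. of_bit (coeff p i) * x ^ (2 ^ Suc i))"
    by (subst sum.lessThan_Suc_shift) (simp add: lessThan_Suc_atMost)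
  also have "(\<Sum>i\<le>degree p. of_bit (coeff p i) * x ^ (2 ^ Suc i)) =
      (\<Sum>i\<le>degree p. of_bit (coeff p i) * x ^ (2 ^ i)) ^ (2 ^ 1)"
    unfolding frob_sum
  proof (intro sum.cong refl)
    fix i show "of_bit (coeff p i) * x ^ 2 ^ Suc i = (of_bit (coeff p i) * x ^ 2 ^ i) ^ 2 ^ 1"
      by (cases "coeff p i") (simp_all add: mult.commute flip: power_mult)
  qed
  finally show ?thesis by (simp add: act_def)
qed

lemma act_1 [simp]: "act 1 x = x"
  by (simp add: act_pCons one_pCons)

lemma act_add: "act (p + q) x = act p x + act q x"
proof -
  define N where "N = Suc (max (degree p) (degree q))"
  have "act p x = (\<Sum>i<N. of_bit (coeff p i) * x ^ (2 ^ i))"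
    "act q x = (\<Sum>i<N. of_bit (coeff q i) * x ^ (2 ^ i))"
    "act (p + q) x = (\<Sum>i<N. of_bit (coeff (p + q) i) * x ^ (2 ^ i))"
    by (rule act_eq_sum_lessThan; simp add: N_def coeff_eq_0)+
  thus ?thesis
    by (simp only: coeff_add of_bit_add distrib_right sum.distrib)
qed

lemma act_at_0 [simp]: "act p 0 = 0"
  by (simp add: act_def zero_power)

lemma act_plus: "act p (x + y) = act p x + act p y"
  by (simp add: act_def frob_add distrib_left sum.distrib)

lemma act_mult: "act (p * q) x = act p (act q x)"
proof (induction p)
  case (pCons a p)
  have "act (smult a q) x = of_bit a * act q x"
    by (cases a) auto
  thus ?case by (simp add: act_add act_pCons pCons)
qed simp

lemma act_monom: "act (monom 1 k) x = x ^ (2 ^ k)"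
  by (induction k)
    (simp_all add: monom_Suc act_pCons mult.commute flip: one_poly_eq_simps power_mult)

lemma act_X_power_n_plus_1: "act (monom 1 n + 1) x = 0"
  by (simp add: act_add act_monom)

text \<open>The kernel consists of the roots of the linearised polynomial \<open>L\<close>, whose
  degree is at most \<open>2 ^ degree p\<close>.\<close>

lemma card_act_kernel_le:
  assumes "p \<noteq> 0"
  shows "card {x. act p x = 0} \<le> 2 ^ degree p"
proof -
  define L :: "'a poly" where "L = (\<Sum>i\<le>degree p. monom (of_bit (coeff p i)) (2 ^ i))"
  have "poly L x = act p x" for x
    by (simp add: L_def act_def poly_sum poly_monom)
  moreover have "L \<noteq> 0"
  proof
    assume "L = 0"
    hence "0 = coeff L (2 ^ degree p)" by simp
    also have "\<dots> = (\<Sum>i\<le>degree p. if i = degree p then of_bit (coeff p i) else 0)"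
    proof -
      have "(2 :: nat) ^ i = 2 ^ degree p \<longleftrightarrow> i = degree p" for i by simp
      thus ?thesis by (simp only: L_def coeff_sum coeff_monom)
    qed
    also have "\<dots> = of_bit (lead_coeff p)"
      by (subst sum.delta) (simp_all only: finite_atMost atMost_iff order.refl if_True)
    finally have "lead_coeff p = 0" by (metis of_bit_eq_0_iff)
    thus False using assms by (simp only: leading_coeff_0_iff)
  qed
  moreover have "degree L \<le> 2 ^ degree p"
    unfolding L_def by (intro degree_sum_le) (auto intro!: order.trans [OF degree_monom_le] power_increasing)
  ultimately show ?thesis
    using card_poly_roots_bound [of L] by simp
qed

text \<open>For the lower bound, the range of \<open>act h\<close> lies in the kernel of
  \<open>act g\<close>, and no fiber of \<open>act h\<close> exceeds \<open>2 ^ degree h\<close>;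
  counting the field by fibers makes the kernel large enough.\<close>

lemma card_act_kernel:
  assumes gh: "monom 1 n + 1 = g * h"
  shows "card {x. act g x = 0} = 2 ^ degree g"
proof (rule antisym)
  have "coeff (monom 1 n + 1 :: bit poly) n \<noteq> 0"
    using n_pos by (simp add: coeff_1)
  hence nz: "g \<noteq> 0" "h \<noteq> 0" using gh by auto
  show "card {x. act g x = 0} \<le> 2 ^ degree g" using nz by (intro card_act_kernel_le)
  have "degree (monom 1 n + 1 :: bit poly) = n"
    using n_pos by (subst degree_add_eq_left) (auto simp: degree_monom_eq)
  hence deg: "n = degree g + degree h" using nz by (simp add: gh degree_mult_eq)
  have fiber: "card {x. act h x = y} \<le> 2 ^ degree h" if "y \<in> range (act h)" for y
  proof -
    obtain x0 where x0: "y = act h x0" using \<open>y \<in> range (act h)\<close> by blast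
    have "card {x. act h x = y} \<le> card {x. act h x = 0}"
      by (rule card_inj_on_le [of "\<lambda>x. x + x0"]) (auto simp: inj_on_def act_plus x0)
    thus ?thesis using card_act_kernel_le [OF nz(2)] by linarith
  qed
  have "2 ^ n = card (\<Union>y\<in>range (act h). {x. act h x = y})"
    by (auto simp flip: card_field intro: arg_cong [of _ _ card])
  also have "\<dots> \<le> (\<Sum>y\<in>range (act h). card {x. act h x = y})"
    by (rule card_UN_le) simp
  also have "\<dots> \<le> (\<Sum>y\<in>range (act h). 2 ^ degree h)"
    using fiber by (rule sum_mono)
  also have "\<dots> = card (range (act h)) * 2 ^ degree h" by simp
  also have "card (range (act h)) \<le> card {x. act g x = 0}"
    by (rule card_mono) (auto simp flip: act_mult gh simp: act_X_power_n_plus_1)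
  finally have "2 ^ degree g * 2 ^ degree h \<le> card {x. act g x = 0} * 2 ^ degree h"
    by (simp add: deg power_add)
  thus "2 ^ degree g \<le> card {x. act g x = 0}" by simp
qed

text \<open>By Bezout, \<open>G\<close> is a combination of \<open>p\<close> and
  \<open>monom 1 n + 1\<close>. The latter acts as zero, so \<open>p\<close> and \<open>G\<close>
  have the same kernel.\<close>

lemma card_act_kernel_coprime:
  assumes "p = G * C" and GH: "monom 1 n + 1 = G * H" and "coprime C H"
  shows "card {x. act p x = 0} = 2 ^ degree G"
proof -
  obtain u v where uv: "u * C + v * H = 1"
    using bezout_coefficients_fst_snd [of C H] assms(3) by (metis coprime_iff_gcd_eq_1)
  have G: "G = u * p + v * (monom 1 n + 1)"
  proof -
    have "u * p + v * (monom 1 n + 1) = G * (u * C + v * H)"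
      unfolding assms(1) GH by (simp add: algebra_simps)
    thus ?thesis by (simp add: uv)
  qed
  have "act G x = 0" if "act p x = 0" for x
    by (subst G, subst act_add) (simp only: act_mult that act_X_power_n_plus_1 act_at_0 add_0)
  moreover have "act p x = 0" if "act G x = 0" for x
    unfolding assms(1) by (subst mult.commute) (simp add: act_mult that)
  ultimately have "{x. act p x = 0} = {x. act G x = 0}" by blast
  thus ?thesis by (simp only: card_act_kernel [OF GH])
qed

section \<open>Trace and character sums\<close>

lemma trace_add: "abs_trace k (x + y) = abs_trace k x + abs_trace k (y :: 'a)"
  by (simp add: abs_trace_def frob_add sum.distrib)

lemma trace_0 [simp]: "abs_trace k 0 = (0 :: 'a)"
  by (simp add: abs_trace_def zero_power)

lemma trace_sum: "abs_trace k (\<Sum>j\<in>J. f j) = (\<Sum>j\<in>J. abs_trace k (f j :: 'a))"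
  by (induction J rule: infinite_finite_induct) (simp_all add: trace_add)

lemma trace_in_F2: "abs_trace n x \<in> (F2 :: 'a set)"
  by (rule abs_trace_in_F2) simp_all

lemma trace_frob: "abs_trace n (x ^ (2 ^ j)) = abs_trace n (x :: 'a)"
proof (induction j)
  case (Suc j)
  have "abs_trace n (x ^ (2 ^ Suc j)) = abs_trace n (x ^ (2 ^ j)) ^ (2 ^ 1)"
    unfolding abs_trace_def frob_sum by (simp add: mult_ac flip: power_mult)
  also have "\<dots> = abs_trace n (x ^ (2 ^ j))"
    using trace_in_F2 [of "x ^ (2 ^ j)"] by (auto simp: F2_def)
  finally show ?case using Suc by simp
qed simp

text \<open>The trace is the action of 1 + X + ... + X^(n-1), whose degree is too small for it to
  vanish on the whole field.\<close>

lemma trace_nontrivial: "\<exists>x. abs_trace n x \<noteq> (0 :: 'a)"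
proof (rule ccontr)
  assume *: "\<not> (\<exists>x. abs_trace n x \<noteq> (0 :: 'a))"
  define p :: "bit poly" where "p = Poly (replicate n 1)"
  have coeff_p: "coeff p i = (if i < n then 1 else 0)" for i
    by (simp add: p_def nth_default_def)
  have "act p x = abs_trace n x" for x
    by (subst act_eq_sum_lessThan [of n]) (simp_all add: coeff_p abs_trace_def)
  hence "{x. act p x = 0} = UNIV" using * by simp
  moreover have "p \<noteq> 0" using n_pos by (auto simp: poly_eq_iff coeff_p)
  moreover from this have "degree p < n"
    using coeff_p [of "degree p"] leading_coeff_neq_0 [of p] by presburger
  ultimately show False
    using card_act_kernel_le [of p] by (simp add: card_field)
qed

lemma F2_add: "u \<in> F2 \<Longrightarrow> v \<in> F2 \<Longrightarrow> u + v \<in> (F2 :: 'a set)"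
  by (auto simp: F2_def)

text \<open>On \<open>F2\<close> this is the nontrivial additive character, with integer
  values.\<close>

definition chi :: "'a \<Rightarrow> int" where
  "chi v = (if v = 0 then 1 else - 1)"

lemma chi_0 [simp]: "chi 0 = 1" and chi_1 [simp]: "chi 1 = - 1"
  by (simp_all add: chi_def)

lemma chi_add: "u \<in> F2 \<Longrightarrow> v \<in> F2 \<Longrightarrow> chi (u + v) = chi u * chi v"
  by (auto simp: F2_def)

text \<open>Translation by an element with nonzero value permutes \<open>K\<close> and changes the
  sign of the sum.\<close>

lemma sum_chi_additive:
  fixes K :: "'a set"
  assumes K: "\<And>x y. x \<in> K \<Longrightarrow> y \<in> K \<Longrightarrow> x + y \<in> K"
    and f: "\<And>x. x \<in> K \<Longrightarrow> f x \<in> F2"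
    and add: "\<And>x y. x \<in> K \<Longrightarrow> y \<in> K \<Longrightarrow> f (x + y) = f x + f y"
  shows "(\<Sum>x\<in>K. chi (f x)) = (if \<forall>x\<in>K. f x = 0 then int (card K) else 0)"
proof (cases "\<forall>x\<in>K. f x = 0")
  case False
  then obtain z where z: "z \<in> K" "f z \<noteq> 0" by auto
  have "(\<Sum>x\<in>K. chi (f x)) = (\<Sum>x\<in>K. chi (f (x + z)))"
    by (rule sum.reindex_bij_witness [of _ "\<lambda>x. x + z" "\<lambda>x. x + z"])
      (auto simp: K z add.assoc)
  also have "\<dots> = (\<Sum>x\<in>K. - chi (f x))"
    using z f by (intro sum.cong) (auto simp: add chi_add, simp add: chi_def)
  finally show ?thesis using False by (auto simp: sum_negf)
qed simp

lemma trace_nondegenerate: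
  assumes "\<And>x. abs_trace n (x * c) = abs_trace n (x * d)"
  shows "c = (d :: 'a)"
proof (rule ccontr)
  assume "c \<noteq> d"
  hence nz: "c + d \<noteq> 0" by (metis add_add_self add_0)
  have "abs_trace n x = 0" for x :: 'a
  proof -
    have "abs_trace n (x / (c + d) * (c + d)) = 0"
      by (simp only: distrib_left trace_add assms add_self)
    thus ?thesis using nz by simp
  qed
  thus False using trace_nontrivial by blast
qed

lemma sum_chi_trace: "(\<Sum>x\<in>UNIV. chi (abs_trace n (x * c))) = (if c = 0 then 2 ^ n else 0)"
proof -
  have "c = 0" if "\<forall>x. abs_trace n (x * c) = 0"
    by (rule trace_nondegenerate) (simp add: that)
  thus ?thesis
    using sum_chi_additive [of UNIV "\<lambda>x. abs_trace n (x * c)"]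
    by (auto simp: trace_in_F2 distrib_right trace_add card_field)
qed

lemma sum_chi_eq_weight:
  "(\<Sum>x\<in>UNIV. chi (f x)) = 2 ^ n - 2 * int (card {x :: 'a. f x \<noteq> 0})"
proof -
  have "(\<Sum>x\<in>UNIV. chi (f x)) = (\<Sum>x\<in>UNIV. 1 - 2 * of_bool (f x \<noteq> 0))"
    by (intro sum.cong) (auto simp: chi_def)
  thus ?thesis
    by (simp add: sum_subtractf card_field flip: sum_distrib_left)
qed

end

section \<open>Walsh spectrum of a quadratic form\<close>

text \<open>\<open>L\<close> represents the polar form of \<open>Q\<close> through the trace; its
  kernel is the radical and \<open>k\<close> is the rank.\<close>

locale binary_quadratic_form = binary_field n field
  for n and field :: "'a :: finite_field itself" +
  fixes Q L :: "'a \<Rightarrow> 'a" and k :: nat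
  assumes Q_in_F2: "Q x \<in> F2"
    and polar: "Q (x + y) = Q x + Q y + abs_trace n (y * L x)"
    and L_add: "L (x + y) = L x + L y"
    and card_radical: "card {x. L x = 0} = 2 ^ (n - k)"
    and k_le: "k \<le> n"
begin

definition walsh :: "'a \<Rightarrow> int" where
  "walsh b = (\<Sum>x\<in>UNIV. chi (Q x + abs_trace n (b * x)))"

lemma L_0: "L 0 = 0"
  using L_add [of 0 0] by simp

lemma Q_0: "Q 0 = 0"
  using polar [of 0 0] by simp

lemma affine_in_F2: "Q x + abs_trace n (b * x) \<in> F2"
  by (intro F2_add Q_in_F2 trace_in_F2)

text \<open>The linear terms cancel, so the polar form, and with it \<open>L\<close>, can be
  recovered from \<open>Q\<close> plus any linear function.\<close>

lemma polar_affine: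
  "(Q (x + y) + abs_trace n (b * (x + y))) + (Q x + abs_trace n (b * x)) + (Q y + abs_trace n (b * y)) =
    abs_trace n (y * L x)"
proof -
  have "(u + v + w + (s + r)) + (u + s) + (v + r) = w + (u + u) + (v + v) + (s + s) + (r + r)"
    for u v w r s :: 'a
    by (simp only: add_ac)
  thus ?thesis by (simp only: polar distrib_left trace_add add_self add_0_right)
qed

text \<open>
  After the substitution \<open>y = u + x\<close> in the double sum, the sum over \<open>x\<close> vanishes unless \<open>u\<close> lies in
  the radical.
\<close>

lemma walsh_square: "walsh b ^ 2 = 2 ^ n * (\<Sum>u | L u = 0. chi (Q u + abs_trace n (b * u)))"
proof -
  let ?f = "\<lambda>x. Q x + abs_trace n (b * x)"
  have "walsh b ^ 2 = (\<Sum>x\<in>UNIV. \<Sum>y\<in>UNIV. chi (?f x) * chi (?f y))"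
    by (simp add: walsh_def power2_eq_square sum_product)
  also have "\<dots> = (\<Sum>x\<in>UNIV. \<Sum>u\<in>UNIV. chi (?f x) * chi (?f (u + x)))"
  proof (rule sum.cong [OF refl])
    fix x
    show "(\<Sum>y\<in>UNIV. chi (?f x) * chi (?f y)) = (\<Sum>u\<in>UNIV. chi (?f x) * chi (?f (u + x)))"
      by (rule sum.reindex_bij_witness [of _ "\<lambda>u. u + x" "\<lambda>u. u + x"]) simp_all
  qed
  also have "\<dots> = (\<Sum>x\<in>UNIV. \<Sum>u\<in>UNIV. chi (?f u) * chi (abs_trace n (x * L u)))"
  proof (intro sum.cong refl)
    fix x u
    have "?f (u + x) = ?f x + (?f u + abs_trace n (x * L u))"
      by (simp add: polar distrib_left trace_add add_ac)
    hence "chi (?f (u + x)) = chi (?f x) * (chi (?f u) * chi (abs_trace n (x * L u)))"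
      by (simp only: chi_add F2_add affine_in_F2 trace_in_F2)
    moreover have "chi (?f x) * chi (?f x) = 1" by (simp add: chi_def)
    ultimately show "chi (?f x) * chi (?f (u + x)) = chi (?f u) * chi (abs_trace n (x * L u))"
      by (metis mult.assoc mult_1)
  qed
  also have "\<dots> = (\<Sum>u\<in>UNIV. chi (?f u) * (\<Sum>x\<in>UNIV. chi (abs_trace n (x * L u))))"
    by (subst sum.swap) (simp add: sum_distrib_left)
  also have "\<dots> = (\<Sum>u\<in>UNIV. if L u = 0 then chi (?f u) * 2 ^ n else 0)"
    by (intro sum.cong refl) (simp add: sum_chi_trace)
  also have "\<dots> = 2 ^ n * (\<Sum>u | L u = 0. chi (?f u))"
    by (simp add: sum.If_cases sum_distrib_left mult.commute)
  finally show ?thesis .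
qed

text \<open>On the radical the polar form vanishes, so the exponent in \<open>walsh_square\<close>
  is additive there and \<open>sum_chi_additive\<close> applies.\<close>

lemma walsh_cases: "walsh b = 0 \<or> walsh b ^ 2 = 2 ^ (2 * n - k)"
proof -
  have "(\<Sum>u | L u = 0. chi (Q u + abs_trace n (b * u))) \<in> {0, int (2 ^ (n - k))}"
    by (subst sum_chi_additive)
      (auto simp: L_add affine_in_F2 polar distrib_left trace_add card_radical add_ac)
  moreover have "2 ^ n * 2 ^ (n - k) = (2 ^ (2 * n - k) :: int)"
    using k_le by (simp flip: power_add)
  ultimately have "walsh b ^ 2 = 0 \<or> walsh b ^ 2 = 2 ^ (2 * n - k)"
    by (auto simp: walsh_square)
  thus ?thesis by simp
qed

text \<open>Parseval's identity: summing over \<open>b\<close> first leaves only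
  \<open>u = 0\<close>.\<close>

lemma sum_walsh_square: "(\<Sum>b\<in>UNIV. walsh b ^ 2) = 2 ^ (2 * n)"
proof -
  have "(\<Sum>b\<in>UNIV. walsh b ^ 2) =
      2 ^ n * (\<Sum>u | L u = 0. \<Sum>b\<in>UNIV. chi (Q u) * chi (abs_trace n (b * u)))"
    unfolding walsh_square
    by (subst sum.swap) (simp add: sum_distrib_left chi_add Q_in_F2 trace_in_F2)
  also have "\<dots> = 2 ^ n * (\<Sum>u | L u = 0. if u = 0 then 2 ^ n else 0)"
  proof -
    have "(\<Sum>b\<in>UNIV. chi (Q u) * chi (abs_trace n (b * u))) = (if u = 0 then 2 ^ n else 0)" for u
      by (simp add: sum_chi_trace Q_0 flip: sum_distrib_left)
    thus ?thesis by (simp only:)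
  qed
  also have "\<dots> = 2 ^ (2 * n)"
    by (simp add: sum.delta' L_0 mult_2 power_add)
  finally show ?thesis .
qed

text \<open>The nonzero squares all equal \<open>2 ^ (2 * n - k)\<close> and add up to
  \<open>2 ^ (2 * n)\<close>.\<close>

lemma card_walsh_nonzero: "card {b. walsh b \<noteq> 0} = 2 ^ k"
proof -
  have "2 ^ (2 * n) = (\<Sum>b | walsh b \<noteq> 0. walsh b ^ 2)"
    unfolding sum_walsh_square [symmetric] by (intro sum.mono_neutral_right) auto
  also have "\<dots> = (\<Sum>b | walsh b \<noteq> 0. 2 ^ (2 * n - k))"
    using walsh_cases by (intro sum.cong) auto
  also have "\<dots> = int (card {b. walsh b \<noteq> 0}) * 2 ^ (2 * n - k)"
    by simp
  finally have "int (card {b. walsh b \<noteq> 0}) * 2 ^ (2 * n - k) = 2 ^ k * 2 ^ (2 * n - k)"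
    using k_le by (simp flip: power_add)
  hence "int (card {b. walsh b \<noteq> 0}) = 2 ^ k" by simp
  thus ?thesis by (metis of_nat_eq_iff of_nat_numeral of_nat_power)
qed

lemma sum_chi_codeword:
  assumes "c \<in> F2"
  shows "(\<Sum>x\<in>UNIV. chi (Q x + (abs_trace n (b * x) + c))) = chi c * walsh b"
proof -
  have "chi (Q x + (abs_trace n (b * x) + c)) = chi c * chi (Q x + abs_trace n (b * x))" for x
    unfolding add.assoc [symmetric] using assms by (subst chi_add) (auto simp: affine_in_F2)
  thus ?thesis by (simp add: walsh_def sum_distrib_left)
qed

lemma weight_eq_half_iff:
  assumes "c \<in> F2"
  shows "card {x. Q x + (abs_trace n (b * x) + c) \<noteq> 0} = 2 ^ (n - 1) \<longleftrightarrow> walsh b = 0"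
proof -
  let ?w = "card {x. Q x + (abs_trace n (b * x) + c) \<noteq> 0}"
  have "chi c * walsh b = 2 ^ n - 2 * int ?w"
    unfolding sum_chi_codeword [OF assms, symmetric] by (rule sum_chi_eq_weight)
  moreover have "(2 :: int) ^ n = 2 * int (2 ^ (n - 1))"
    using n_pos by (simp flip: power_Suc)
  moreover have "walsh b = 0 \<longleftrightarrow> chi c * walsh b = 0" by (simp add: chi_def)
  ultimately have "walsh b = 0 \<longleftrightarrow> int ?w = int (2 ^ (n - 1))" by linarith
  thus ?thesis by simp
qed

text \<open>An excess \<open>d\<close> over half the length means a character sum of
  \<open>- 2 * d\<close>. A nonzero sum has a square that depends on \<open>k\<close> alone, so
  comparing squares forces \<open>j = k\<close>, and the sign remains.\<close>

lemma weight_eq_above_half_iff: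
  assumes "c \<in> F2"
  shows "real (card {x. Q x + (abs_trace n (b * x) + c) \<noteq> 0}) =
      2 ^ (n - 1) + 2 powr (real n - 1 - real j / 2) \<longleftrightarrow> j = k \<and> chi c * walsh b < 0"
proof -
  let ?w = "card {x. Q x + (abs_trace n (b * x) + c) \<noteq> 0}"
  let ?T = "real_of_int (chi c * walsh b)"
  have "chi c * walsh b = 2 ^ n - 2 * int ?w"
    unfolding sum_chi_codeword [OF assms, symmetric] by (rule sum_chi_eq_weight)
  hence "?T = 2 ^ n - 2 * real ?w" by simp
  moreover have "(2 :: real) ^ n = 2 * 2 ^ (n - 1)"
    using n_pos by (simp flip: power_Suc)
  moreover have "2 powr (real n - real j / 2) = 2 * 2 powr (real n - 1 - real j / 2)"
    by (simp add: powr_diff)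
  ultimately have "real ?w = 2 ^ (n - 1) + 2 powr (real n - 1 - real j / 2) \<longleftrightarrow>
      ?T = - (2 powr (real n - real j / 2))"
    by linarith
  also have "\<dots> \<longleftrightarrow> j = k \<and> ?T < 0"
  proof -
    have square: "(2 powr (real n - real i / 2)) ^ 2 = 2 powr (2 * real n - real i)" for i
      by (simp add: power2_eq_square flip: powr_add)
    have "?T ^ 2 = 0 \<or> ?T ^ 2 = 2 powr (2 * real n - real k)"
    proof -
      have "?T ^ 2 = real_of_int (walsh b ^ 2)" by (simp add: chi_def)
      moreover have "2 powr (2 * real n - real k) = real_of_int (2 ^ (2 * n - k))"
        using k_le by (simp add: of_nat_diff flip: powr_realpow)
      ultimately show ?thesis using walsh_cases [of b] by (metis of_int_0 zero_power2)
    qed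
    hence T: "?T = 0 \<or> ?T ^ 2 = (2 powr (real n - real k / 2)) ^ 2" by (simp only: square zero_eq_power2)
    show ?thesis
    proof
      assume eq: "?T = - (2 powr (real n - real j / 2))"
      hence neg: "?T < 0" by simp
      hence "(2 powr (real n - real j / 2)) ^ 2 = (2 powr (real n - real k / 2)) ^ 2"
        using T eq by (metis less_irrefl power2_minus)
      hence "j = k" unfolding square by (simp add: powr_inj)
      thus "j = k \<and> ?T < 0" using neg by simp
    next
      assume "j = k \<and> ?T < 0"
      moreover from this have "?T = 2 powr (real n - real k / 2) \<or> ?T = - (2 powr (real n - real k / 2))"
        using T by (auto simp: power2_eq_iff simp del: powr_gt_zero)
      moreover have "2 powr (real n - real k / 2) > 0" by simp
      ultimately show "?T = - (2 powr (real n - real j / 2))" by (elim conjE) (simp only:, linarith)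
    qed
  qed
  finally show ?thesis by (simp only: of_int_less_0_iff)
qed

text \<open>For each \<open>b\<close> with \<open>walsh b \<noteq> 0\<close> exactly one constant
  \<open>c\<close> makes the sum negative.\<close>

lemma card_negative: "card {(b, c). c \<in> F2 \<and> chi c * walsh b < 0} = 2 ^ k"
proof -
  have "bij_betw fst {(b, c). c \<in> F2 \<and> chi c * walsh b < 0} {b. walsh b \<noteq> 0}"
    by (rule bij_betw_byWitness [where f' = "\<lambda>b. (b, if walsh b < 0 then 0 else 1)"])
      (auto simp: F2_def split: if_splits)
  from bij_betw_same_card [OF this] show ?thesis by (simp only: card_walsh_nonzero)
qed

lemma card_balanced: "card {(b, c :: 'a). c \<in> F2 \<and> walsh b = 0} = 2 ^ (n + 1) - 2 * 2 ^ k"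
proof -
  have "card {(b, c :: 'a). c \<in> F2 \<and> walsh b = 0} = card ((- {b. walsh b \<noteq> 0}) \<times> (F2 :: 'a set))"
    by (rule arg_cong [of _ _ card]) auto
  also have "\<dots> = (2 ^ n - 2 ^ k) * 2"
  proof -
    have "card (- {b. walsh b \<noteq> 0}) = 2 ^ n - 2 ^ k"
      by (simp add: Compl_eq_Diff_UNIV card_Diff_subset card_walsh_nonzero card_field)
    moreover have "card (F2 :: 'a set) = 2" by (simp add: F2_def)
    ultimately show ?thesis by (simp only: card_cartesian_product)
  qed
  also have "\<dots> = 2 ^ (n + 1) - 2 * 2 ^ k" by (simp add: diff_mult_distrib)
  finally show ?thesis .
qed

end

section \<open>Weights of the codewords\<close>

lemma hamming_weight_map:
  assumes "distinct as" "set as = UNIV"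
  shows "hamming_weight (map f as) = card {x. f x \<noteq> 0}"
proof -
  have "bij_betw ((!) as) {i. i < length (map f as) \<and> map f as ! i \<noteq> 0} {x. f x \<noteq> 0}"
    unfolding bij_betw_def
  proof
    show "inj_on ((!) as) {i. i < length (map f as) \<and> map f as ! i \<noteq> 0}"
      using assms(1) by (auto simp: inj_on_def nth_eq_iff_index_eq)
    show "(!) as ` {i. i < length (map f as) \<and> map f as ! i \<noteq> 0} = {x. f x \<noteq> 0}"
    proof safe
      fix x assume "f x \<noteq> 0"
      moreover obtain i where "i < length as" "as ! i = x"
        using assms(2) by (metis UNIV_I in_set_conv_nth)
      ultimately show "x \<in> (!) as ` {i. i < length (map f as) \<and> map f as ! i \<noteq> 0}" by force
    qed simp
  qed
  thus ?thesis unfolding hamming_weight_def by (rule bij_betw_same_card)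
qed

context binary_field
begin

text \<open>The cosets are counted separately, which requires that a word determines
  \<open>(p, b, c)\<close>: its value at 0 gives \<open>c\<close>, polarisation gives
  \<open>L p\<close> and thus \<open>p\<close>, and nondegeneracy of the trace gives
  \<open>b\<close>.\<close>

lemma code_of_quadratic_forms:
  fixes Q L :: "'p \<Rightarrow> 'a \<Rightarrow> 'a" and k :: "'p \<Rightarrow> nat"
  assumes ordering: "distinct as" "set as = UNIV" and fin: "finite \<P>"
    and form: "\<And>p. p \<in> \<P> \<Longrightarrow> binary_quadratic_form n (Q p) (L p) (k p)"
    and inj: "\<And>p q. p \<in> \<P> \<Longrightarrow> q \<in> \<P> \<Longrightarrow> L p = L q \<Longrightarrow> p = q"
  shows W_poly_quadratic_forms: "W_poly n as (Q ` \<P>) = (\<Sum>p\<in>\<P>. monom (2 ^ k p) (k p))"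
    and A_mid_quadratic_forms: "real (A_mid n as (Q ` \<P>)) = (\<Sum>p\<in>\<P>. 2 ^ (n + 1) - 2 * 2 ^ k p)"
proof -
  define word where "word = (\<lambda>(p, b, c). map (\<lambda>x. Q p x + (abs_trace n (b * x) + c)) as)"
  define T where "T = \<P> \<times> (UNIV :: 'a set) \<times> (F2 :: 'a set)"
  have code: "R_code n as (Q ` \<P>) = word ` T"
  proof (intro equalityI subsetI)
    fix w assume "w \<in> R_code n as (Q ` \<P>)"
    then obtain p b c where "p \<in> \<P>" "c \<in> F2" "w = word (p, b, c)"
      by (auto simp: R_code_def affine_funs_def word_def)
    thus "w \<in> word ` T" by (auto simp: T_def)
  next
    fix w assume "w \<in> word ` T"
    then obtain p b c where "p \<in> \<P>" "c \<in> F2"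
        "w = map (\<lambda>x. Q p x + (abs_trace n (b * x) + c)) as"
      by (auto simp: T_def word_def)
    moreover from this have "(\<lambda>x. abs_trace n (b * x) + c) \<in> affine_funs n"
      by (auto simp: affine_funs_def)
    ultimately show "w \<in> R_code n as (Q ` \<P>)"
      unfolding R_code_def by (intro CollectI exI [of _ "Q p"] exI [of _ "\<lambda>x. abs_trace n (b * x) + c"]) auto
  qed
  have inj_word: "inj_on word T"
  proof (rule inj_onI)
    fix s t assume "s \<in> T" "t \<in> T" "word s = word t"
    moreover obtain p b c where s: "s = (p, b, c)" by (metis prod_cases3)
    moreover obtain q b' c' where t: "t = (q, b', c')" by (metis prod_cases3)
    ultimately have T: "(p, b, c) \<in> T" "(q, b', c') \<in> T" and eq: "word (p, b, c) = word (q, b', c')"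
      by simp_all
    interpret p: binary_quadratic_form n _ "Q p" "L p" "k p" using form T by (auto simp: T_def)
    interpret q: binary_quadratic_form n _ "Q q" "L q" "k q" using form T by (auto simp: T_def)
    have eq: "Q p x + (abs_trace n (b * x) + c) = Q q x + (abs_trace n (b' * x) + c')" for x
      using eq ordering by (auto simp: word_def)
    from eq [of 0] have "c = c'" by (simp add: p.Q_0 q.Q_0)
    with eq have eq: "Q p x + abs_trace n (b * x) = Q q x + abs_trace n (b' * x)" for x
      by (simp flip: add.assoc)
    have "L p x = L q x" for x
    proof (rule trace_nondegenerate)
      fix y
      show "abs_trace n (y * L p x) = abs_trace n (y * L q x)"
        using p.polar_affine [of x y b] q.polar_affine [of x y b'] by (simp only: eq)
    qed
    hence "p = q" using T by (intro inj ext) (auto simp: T_def)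
    with eq have "abs_trace n (x * b) = abs_trace n (x * b')" for x
      by (simp add: mult.commute [of x])
    hence "b = b'" by (rule trace_nondegenerate)
    thus "s = t" using \<open>p = q\<close> \<open>c = c'\<close> by (simp add: s t)
  qed
  have finite_F2: "finite (F2 :: 'a set)" by (simp add: F2_def)
  have count: "card {w \<in> R_code n as (Q ` \<P>). \<Phi> (hamming_weight w)} =
    (\<Sum>p\<in>\<P>. card {(b, c). c \<in> F2 \<and> \<Phi> (card {x. Q p x + (abs_trace n (b * x) + c) \<noteq> 0})})"
    for \<Phi> :: "nat \<Rightarrow> bool"
  proof -
    have "{w \<in> R_code n as (Q ` \<P>). \<Phi> (hamming_weight w)} =
        word ` {t \<in> T. \<Phi> (hamming_weight (word t))}"
      unfolding code by auto
    hence "card {w \<in> R_code n as (Q ` \<P>). \<Phi> (hamming_weight w)} =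
        card {t \<in> T. \<Phi> (hamming_weight (word t))}"
      by (simp add: card_image inj_on_subset [OF inj_word])
    also have "{t \<in> T. \<Phi> (hamming_weight (word t))} = (SIGMA p:\<P>. {(b, c). c \<in> F2 \<and>
        \<Phi> (card {x. Q p x + (abs_trace n (b * x) + c) \<noteq> 0})})"
      by (auto simp: T_def word_def hamming_weight_map [OF ordering])
    also have "card \<dots> = (\<Sum>p\<in>\<P>. card {(b, c). c \<in> F2 \<and>
        \<Phi> (card {x. Q p x + (abs_trace n (b * x) + c) \<noteq> 0})})"
      using fin by (intro card_SigmaI) auto
    finally show ?thesis .
  qed
  have A_num: "A_num n as (Q ` \<P>) j = (\<Sum>p\<in>\<P>. if k p = j then 2 ^ k p else 0)" for j
    unfolding A_num_def count [of "\<lambda>w. real w = 2 ^ (n - 1) + 2 powr (real n - 1 - real j / 2)"]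
  proof (intro sum.cong refl)
    fix p assume "p \<in> \<P>"
    then interpret p: binary_quadratic_form n _ "Q p" "L p" "k p" using form by auto
    have "{(b, c). c \<in> F2 \<and> real (card {x. Q p x + (abs_trace n (b * x) + c) \<noteq> 0}) =
        2 ^ (n - 1) + 2 powr (real n - 1 - real j / 2)} =
        {(b, c). c \<in> F2 \<and> j = k p \<and> chi c * p.walsh b < 0}"
      using p.weight_eq_above_half_iff by auto
    thus "card {(b, c). c \<in> F2 \<and> real (card {x. Q p x + (abs_trace n (b * x) + c) \<noteq> 0}) =
        2 ^ (n - 1) + 2 powr (real n - 1 - real j / 2)} = (if k p = j then 2 ^ k p else 0)"
      using p.card_negative by (cases "k p = j") auto
  qed
  have "W_poly n as (Q ` \<P>) = (\<Sum>j=0..n. \<Sum>p\<in>\<P>. if k p = j then monom (2 ^ k p) (k p) else 0)"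
    unfolding W_poly_def A_num
  proof (rule sum.cong [OF refl])
    fix j
    have "monom (real (\<Sum>p\<in>\<P>. g p)) j = (\<Sum>p\<in>\<P>. monom (real (g p)) j)" for g
      using fin by (induction \<P> rule: finite_induct) (simp_all add: add_monom [symmetric])
    thus "monom (real (\<Sum>p\<in>\<P>. if k p = j then 2 ^ k p else 0)) j =
        (\<Sum>p\<in>\<P>. if k p = j then monom (2 ^ k p) (k p) else 0)"
      by (simp only:) (rule sum.cong, auto)
  qed
  also have "\<dots> = (\<Sum>p\<in>\<P>. \<Sum>j=0..n. if k p = j then monom (2 ^ k p) (k p) else 0)"
    by (rule sum.swap)
  also have "\<dots> = (\<Sum>p\<in>\<P>. monom (2 ^ k p) (k p))"
  proof (intro sum.cong refl)
    fix p assume "p \<in> \<P>"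
    then interpret p: binary_quadratic_form n _ "Q p" "L p" "k p" using form by auto
    show "(\<Sum>j=0..n. if k p = j then monom (2 ^ k p) (k p) else 0) = monom (2 ^ k p) (k p)"
      using p.k_le by simp
  qed
  finally show "W_poly n as (Q ` \<P>) = (\<Sum>p\<in>\<P>. monom (2 ^ k p) (k p))" .
  show "real (A_mid n as (Q ` \<P>)) = (\<Sum>p\<in>\<P>. 2 ^ (n + 1) - 2 * 2 ^ k p)"
    unfolding A_mid_def count [of "\<lambda>w. w = 2 ^ (n - 1)"] of_nat_sum
  proof (intro sum.cong refl)
    fix p assume "p \<in> \<P>"
    then interpret p: binary_quadratic_form n _ "Q p" "L p" "k p" using form by auto
    have "{(b, c). c \<in> F2 \<and> card {x. Q p x + (abs_trace n (b * x) + c) \<noteq> 0} = 2 ^ (n - 1)} =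
        {(b, c :: 'a). c \<in> F2 \<and> p.walsh b = 0}"
      using p.weight_eq_half_iff by auto
    hence "card {(b, c). c \<in> F2 \<and> card {x. Q p x + (abs_trace n (b * x) + c) \<noteq> 0} = 2 ^ (n - 1)} =
        2 ^ (n + 1) - 2 * 2 ^ k p"
      using p.card_balanced by simp
    moreover have "2 * 2 ^ k p \<le> (2 ^ (n + 1) :: nat)"
      using p.k_le by simp
    ultimately show "real (card {(b, c). c \<in> F2 \<and>
        card {x. Q p x + (abs_trace n (b * x) + c) \<noteq> 0} = 2 ^ (n - 1)}) = 2 ^ (n + 1) - 2 * 2 ^ k p"
      by (simp add: of_nat_diff)
  qed
qed

section \<open>The forms in \<open>C1\<close> and \<open>C2\<close> as palindromes\<close>

lemma trace_F2_mult: "c \<in> F2 \<Longrightarrow> abs_trace k (c * x) = c * abs_trace k (x :: 'a)"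
  by (auto simp: F2_def)

text \<open>A common shape for \<open>C1\<close> at odd \<open>n\<close> and \<open>C2\<close> at
  even \<open>n\<close>: coefficients in \<open>F2\<close> may be taken out of the traces.\<close>

definition quad :: "(nat \<Rightarrow> 'a) \<Rightarrow> 'a \<Rightarrow> 'a" where
  "quad a x = (\<Sum>i=1..(n - 1) div 2. a i * abs_trace n (x ^ (2 ^ i + 1))) +
    (if even n then a (n div 2) * abs_trace (n div 2) (x ^ (2 ^ (n div 2) + 1)) else 0)"

text \<open>The coefficient \<open>a\<^sub>i\<close> of a quadratic form is stored at \<open>X\<^bsup>i-1\<^esup>\<close>, as \<open>a\<^sub>0 = 0\<close>.\<close>

definition poly_coeffs :: "bit poly \<Rightarrow> nat \<Rightarrow> 'a" where
  "poly_coeffs p i = of_bit (coeff p (i - 1))"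

lemma poly_coeffs_in_F2: "poly_coeffs p i \<in> F2"
  by (cases "coeff p (i - 1)") (simp_all add: poly_coeffs_def F2_def)

lemma quad_cong:
  assumes "\<And>i. 1 \<le> i \<Longrightarrow> i \<le> n div 2 \<Longrightarrow> a i = b i"
  shows "quad a = quad b"
proof -
  have "a i = b i" if "i \<in> {1..(n - 1) div 2}" for i
  proof -
    have "(n - 1) div 2 \<le> n div 2" by (rule div_le_mono) simp
    thus ?thesis using that assms by simp
  qed
  moreover have "a (n div 2) = b (n div 2)" if "even n"
  proof -
    have "1 \<le> n div 2" using that n_pos by presburger
    thus ?thesis using assms by simp
  qed
  ultimately show ?thesis by (auto simp: quad_def)
qed

lemma quad_image:
  "{quad a |a. range a \<subseteq> F2} = (\<lambda>p. quad (poly_coeffs p)) ` palindromes (n - 1)"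
proof (intro equalityI subsetI)
  fix f assume "f \<in> {quad a |a. range a \<subseteq> F2}"
  then obtain a where a: "range a \<subseteq> F2" and f: "f = quad a" by auto
  \<comment> \<open>Position \<open>j\<close> belongs to index \<open>j + 1\<close>, whose mirror
    image is \<open>n - (j + 1)\<close>; the smaller of the two is an index that \<open>quad\<close>
    reads.\<close>
  define p :: "bit poly"
    where "p = Poly (map (\<lambda>j. of_bool (a (min (j + 1) (n - 1 - j)) \<noteq> 0)) [0..<n - 1])"
  have coeff_p: "coeff p j = (if j < n - 1 then of_bool (a (min (j + 1) (n - 1 - j)) \<noteq> 0) else 0)" for j
    by (simp add: p_def nth_default_def)
  have "p \<in> palindromes (n - 1)"
    unfolding palindromes_def
  proof (intro CollectI conjI allI impI)
    fix j assume j: "j < n - 1"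
    hence "n - 1 - 1 - j < n - 1" "n - 1 - 1 - j + 1 = n - 1 - j" "n - 1 - (n - 1 - 1 - j) = j + 1"
      by linarith+
    thus "coeff p j = coeff p (n - 1 - 1 - j)"
      using j by (simp only: coeff_p if_True min.commute)
  qed (simp add: coeff_p)
  moreover have "f = quad (poly_coeffs p)"
    unfolding f
  proof (rule quad_cong)
    fix i assume i: "1 \<le> i" "i \<le> n div 2"
    hence "i - 1 < n - 1" "min (i - 1 + 1) (n - 1 - (i - 1)) = i" by linarith+
    hence "coeff p (i - 1) = of_bool (a i \<noteq> 0)" by (simp only: coeff_p if_True)
    moreover have "a i \<in> F2" using a by auto
    ultimately show "a i = poly_coeffs p i" by (auto simp: poly_coeffs_def F2_def)
  qed
  ultimately show "f \<in> (\<lambda>p. quad (poly_coeffs p)) ` palindromes (n - 1)" by blast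
qed (use poly_coeffs_in_F2 in blast)

lemma C1_eq_quad: "odd n \<Longrightarrow> C1 n = {quad a |a. range a \<subseteq> F2}"
proof -
  assume n: "odd n"
  have *: "(\<lambda>x. abs_trace n (\<Sum>i = 1..(n - 1) div 2. a i * x ^ (2 ^ i + 1))) = quad a"
    if "range a \<subseteq> F2" for a
  proof
    fix x
    have "a i \<in> F2" for i using that by auto
    thus "abs_trace n (\<Sum>i = 1..(n - 1) div 2. a i * x ^ (2 ^ i + 1)) = quad a x"
      using n by (simp only: quad_def trace_sum trace_F2_mult if_True if_False add_0_right)
  qed
  thus ?thesis unfolding C1_def
  proof (intro Collect_cong ex_cong1)
    fix Q a
    show "(range a \<subseteq> F2 \<and> Q = (\<lambda>x. abs_trace n (\<Sum>i = 1..(n - 1) div 2. a i * x ^ (2 ^ i + 1)))) \<longleftrightarrow>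
        (Q = quad a \<and> range a \<subseteq> F2)"
      using * [of a] by argo
  qed
qed

lemma C2_eq_quad: "even n \<Longrightarrow> C2 n = {quad a |a. range a \<subseteq> F2}"
proof -
  assume n: "even n"
  hence half: "n div 2 - 1 = (n - 1) div 2" by presburger
  have *: "(\<lambda>x. abs_trace n (\<Sum>i = 1..n div 2 - 1. a i * x ^ (2 ^ i + 1))
      + abs_trace (n div 2) (a (n div 2) * x ^ (2 ^ (n div 2) + 1))) = quad a"
    if "range a \<subseteq> F2" for a
  proof
    fix x
    have "a i \<in> F2" for i using that by auto
    thus "abs_trace n (\<Sum>i = 1..n div 2 - 1. a i * x ^ (2 ^ i + 1))
        + abs_trace (n div 2) (a (n div 2) * x ^ (2 ^ (n div 2) + 1)) = quad a x"
      using n by (simp only: quad_def trace_sum trace_F2_mult if_True if_False half add_0_right)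
  qed
  thus ?thesis unfolding C2_def
  proof (intro Collect_cong ex_cong1)
    fix Q a
    show "(range a \<subseteq> F2 \<and> Q = (\<lambda>x. abs_trace n (\<Sum>i = 1..n div 2 - 1. a i * x ^ (2 ^ i + 1))
        + abs_trace (n div 2) (a (n div 2) * x ^ (2 ^ (n div 2) + 1)))) \<longleftrightarrow>
        (Q = quad a \<and> range a \<subseteq> F2)"
      using * [of a] by argo
  qed
qed

lemma quad_in_F2:
  assumes "range a \<subseteq> F2"
  shows "quad a x \<in> F2"
proof (cases "even n")
  case True
  hence "quad a \<in> C2 n" using assms by (auto simp: C2_eq_quad)
  thus ?thesis using C2_in_F2 card_field True by blast
next
  case False
  hence "quad a \<in> C1 n" using assms by (auto simp: C1_eq_quad)
  thus ?thesis using C1_in_F2 card_field by blast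
qed

lemma power_frob_plus_1_add:
  "(x + y) ^ (2 ^ i + 1) = x ^ (2 ^ i + 1) + y ^ (2 ^ i + 1) + (y * x ^ (2 ^ i) + y ^ (2 ^ i) * (x :: 'a))"
  by (simp add: frob_add algebra_simps)

text \<open>The trace is invariant under the Frobenius map; applying it \<open>n - i\<close> more
  times brings \<open>y\<close> back to the first power.\<close>

lemma trace_swap:
  assumes "i \<le> n"
  shows "abs_trace n (y ^ (2 ^ i) * x) = abs_trace n (y * x ^ (2 ^ (n - i)) :: 'a)"
proof -
  have "abs_trace n (y ^ (2 ^ i) * x) = abs_trace n ((y ^ (2 ^ i) * x) ^ (2 ^ (n - i)))"
    by (simp only: trace_frob)
  also have "(y ^ (2 ^ i) * x) ^ (2 ^ (n - i)) = y * x ^ (2 ^ (n - i))"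
    using assms by (simp only: power_mult_distrib frob_frob le_add_diff_inverse frob_n)
  finally show ?thesis .
qed

text \<open>The two summands are conjugate over the subfield with \<open>2 ^ h\<close> elements, so
  this is transitivity of the trace.\<close>

lemma trace_half:
  assumes "n = h + h"
  shows "abs_trace h (y * x ^ (2 ^ h) + y ^ (2 ^ h) * x) = abs_trace n (y * x ^ (2 ^ h) :: 'a)"
proof -
  define z where "z = y * x ^ (2 ^ h)"
  have "z ^ (2 ^ h) = y ^ (2 ^ h) * x"
    by (simp only: z_def power_mult_distrib frob_frob assms [symmetric] frob_n)
  moreover have "abs_trace (h + k) z = abs_trace h z + abs_trace k (z ^ (2 ^ h))" for k
    by (induction k) (simp_all add: abs_trace_def frob_frob add.assoc)
  ultimately show ?thesis
    by (simp add: trace_add assms flip: z_def)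
qed

lemma sum_symmetric_split:
  fixes c :: "nat \<Rightarrow> 'a"
  shows "(\<Sum>j=1..<n. c j) = (\<Sum>i=1..(n - 1) div 2. c i + c (n - i)) + (if even n then c (n div 2) else 0)"
proof -
  define K where "K = (n - 1) div 2"
  have mid: "(\<Sum>j\<in>{K<..<n - K}. c j) = (if even n then c (n div 2) else 0)"
  proof (cases "even n")
    case True
    hence "{K<..<n - K} = {n div 2}" using n_pos by (auto simp: K_def elim!: evenE)
    thus ?thesis using True by simp
  next
    case False
    hence "{K<..<n - K} = {}" by (auto simp: K_def elim!: oddE)
    thus ?thesis using False by simp
  qed
  have "{1..<n} = {1..K} \<union> ({K<..<n - K} \<union> {n - K..<n})"
    using n_pos by (auto simp: K_def)
  hence "(\<Sum>j=1..<n. c j) = (\<Sum>i=1..K. c i) + ((\<Sum>j\<in>{K<..<n - K}. c j) + (\<Sum>j=n - K..<n. c j))"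
    by (simp only:) (subst sum.union_disjoint; (subst sum.union_disjoint)?; auto simp: K_def)
  also have "(\<Sum>j=n - K..<n. c j) = (\<Sum>i=1..K. c (n - i))"
    by (rule sum.reindex_bij_witness [of _ "\<lambda>i. n - i" "\<lambda>i. n - i"]) (auto simp: K_def)
  finally show ?thesis
    unfolding K_def [symmetric] by (simp add: mid sum.distrib add_ac)
qed

text \<open>The terms \<open>j\<close> and \<open>n - j\<close> have equal coefficients, and by
  \<open>trace_swap\<close> they are the two cross terms of one power
  \<open>x ^ (2 ^ i + 1)\<close>. For even \<open>n\<close> the middle term is matched by
  \<open>trace_half\<close>.\<close>

lemma quad_polar:
  assumes p: "p \<in> palindromes (n - 1)"
  shows "quad (poly_coeffs p) (x + y) = quad (poly_coeffs p) x + quad (poly_coeffs p) y +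
    abs_trace n (y * act p x ^ 2)"
proof -
  define a where "a = poly_coeffs p"
  define c where "c = (\<lambda>j. a j * abs_trace n (y * x ^ (2 ^ j)))"
  have sym: "a (n - i) = a i" if "1 \<le> i" "i < n" for i
  proof -
    have "i - 1 < n - 1" "n - 1 - 1 - (i - 1) = n - i - 1" using that by linarith+
    thus ?thesis using palindromesD(1) [OF p, of "i - 1"] by (simp only: a_def poly_coeffs_def)
  qed
  \<comment> \<open>Squaring multiplies \<open>p\<close> by X and thereby undoes the index shift in
    \<open>poly_coeffs\<close>.\<close>
  have "act p x ^ 2 = act (pCons 0 p) x" by (simp add: act_pCons)
  also have "\<dots> = (\<Sum>j<n. of_bit (coeff (pCons 0 p) j) * x ^ (2 ^ j))"
    using palindromesD(2) [OF p] n_pos by (intro act_eq_sum_lessThan) (auto simp: coeff_pCons split: nat.split)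
  also have "\<dots> = (\<Sum>j=1..<n. a j * x ^ (2 ^ j))"
    by (rule sum.mono_neutral_cong_right)
      (auto simp: a_def poly_coeffs_def coeff_pCons not_le split: nat.split)
  finally have "abs_trace n (y * act p x ^ 2) = (\<Sum>j=1..<n. c j)"
    by (simp add: sum_distrib_left trace_sum c_def a_def mult.left_commute [of y "poly_coeffs p _"]
      trace_F2_mult poly_coeffs_in_F2)
  also have "\<dots> = (\<Sum>i=1..(n - 1) div 2. c i + c (n - i)) + (if even n then c (n div 2) else 0)"
    by (rule sum_symmetric_split)
  also have "(\<Sum>i=1..(n - 1) div 2. c i + c (n - i)) =
      (\<Sum>i=1..(n - 1) div 2. a i * abs_trace n (y * x ^ (2 ^ i) + y ^ (2 ^ i) * x))"
    by (intro sum.cong refl) (auto simp: c_def sym trace_add trace_swap distrib_left)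
  also have "(if even n then c (n div 2) else 0) = (if even n then
      a (n div 2) * abs_trace (n div 2) (y * x ^ (2 ^ (n div 2)) + y ^ (2 ^ (n div 2)) * x) else 0)"
    by (auto simp: c_def trace_half elim!: evenE)
  finally show ?thesis
    unfolding a_def [symmetric] quad_def power_frob_plus_1_add trace_add distrib_left sum.distrib
    by (simp add: add_ac)
qed

lemma quad_form:
  assumes p: "p \<in> palindromes (n - 1)" and k: "k \<le> n" "card {x. act p x = 0} = 2 ^ (n - k)"
  shows "binary_quadratic_form n (quad (poly_coeffs p)) (\<lambda>x. act p x ^ 2) k"
proof
  show "quad (poly_coeffs p) x \<in> F2" for x
    using poly_coeffs_in_F2 by (intro quad_in_F2) blast
qed (use p k in \<open>simp_all add: quad_polar act_plus square_add\<close>)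

text \<open>Otherwise \<open>p + q\<close>, a nonzero polynomial of degree below \<open>n\<close>,
  would annihilate all \<open>2 ^ n\<close> elements.\<close>

lemma act_inject:
  assumes "p \<in> palindromes (n - 1)" "q \<in> palindromes (n - 1)"
    and "(\<lambda>x. act p x ^ 2) = (\<lambda>x. act q x ^ 2)"
  shows "p = q"
proof (rule ccontr)
  assume "p \<noteq> q"
  hence nz: "p + q \<noteq> 0" by (simp add: bit_poly_add_eq_0_iff)
  have "act (p + q) x = 0" for x
  proof -
    have "act (p + q) x ^ 2 = 0" using fun_cong [OF assms(3), of x] by (simp add: act_add square_add)
    thus ?thesis by simp
  qed
  hence "2 ^ n \<le> (2 :: nat) ^ degree (p + q)"
    using card_act_kernel_le [OF nz] by (simp add: card_field)
  moreover have "degree (p + q) < n"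
  proof (rule ccontr)
    assume "\<not> degree (p + q) < n"
    hence "lead_coeff (p + q) = 0"
      using palindromesD(2) [OF assms(1), of "degree (p + q)"] palindromesD(2) [OF assms(2), of "degree (p + q)"]
      by simp
    thus False using nz by (simp only: leading_coeff_0_iff)
  qed
  ultimately show False by simp
qed

end

section \<open>Squarefreeness of X^m + 1 and closed forms of sums\<close>

text \<open>For odd \<open>m\<close> the derivative is X^(m-1). A common divisor of \<open>f\<close>
  and \<open>g\<close> divides it as well as X^m + 1, and these two are coprime.\<close>

lemma coprime_factors_X_power_plus_1:
  assumes "odd m" and eq: "monom 1 m + 1 = f * g * (h :: bit poly)"
  shows "coprime f g"
proof (rule coprimeI)
  fix c assume "c dvd f" "c dvd g"
  then obtain f' g' where "f = c * f'" "g = c * g'" by (auto elim!: dvdE)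
  define e where "e = f' * g' * h"
  have e: "monom 1 m + 1 = c * (c * e)"
    by (simp add: eq \<open>f = c * f'\<close> \<open>g = c * g'\<close> e_def mult_ac)
  have "pderiv (monom 1 m + 1 :: bit poly) = c * (pderiv (c * e) + e * pderiv c)"
    unfolding e by (simp only: pderiv_mult [of c "c * e"] distrib_left mult.assoc)
  moreover have "pderiv (monom 1 m + 1 :: bit poly) = monom 1 (m - 1)"
  proof -
    have "of_nat m = (1 :: bit)" using assms(1) by (auto elim!: oddE)
    thus ?thesis by (simp add: pderiv_add pderiv_monom)
  qed
  ultimately have "c dvd monom 1 (m - 1)" by (metis dvd_triv_left)
  hence "c dvd monom 1 1 * monom 1 (m - 1)" by simp
  hence "c dvd monom 1 m" using assms(1) odd_pos by (simp add: mult_monom)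
  moreover have "c dvd monom 1 m + 1" unfolding e by simp
  ultimately show "is_unit c" by (simp add: dvd_add_right_iff)
qed

lemma monom_prod: "(\<Prod>i\<in>A. monom (c i) (k i)) = monom (\<Prod>i\<in>A. c i :: 'c :: comm_semiring_1) (\<Sum>i\<in>A. k i)"
  by (induction A rule: infinite_finite_induct) (simp_all add: mult_monom)

lemma monom_level_weight:
  assumes "even d" "j \<ge> 1"
  shows "monom (2 ^ (j * d)) (j * d) * (2 ^ (j * d div 2) - 2 ^ ((j - 1) * d div 2)) =
    monom (2 ^ (3 * j * d div 2) - 2 ^ ((3 * j - 1) * d div 2) :: real) (j * d)"
proof -
  obtain c where c: "d = 2 * c" using assms(1) by auto
  obtain i where i: "j = Suc i" using assms(2) by (cases j) auto
  have "(2 :: real poly) ^ k = [:2 ^ k:]" for k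
    by (simp add: poly_const_pow numeral_poly)
  hence "monom (2 ^ (j * d)) (j * d) * (2 ^ (j * d div 2) - 2 ^ ((j - 1) * d div 2)) =
      monom (2 ^ (j * d) * (2 ^ (j * d div 2) - 2 ^ ((j - 1) * d div 2)) :: real) (j * d)"
    by (simp add: smult_monom mult.commute)
  also have "2 ^ (j * d) * (2 ^ (j * d div 2) - 2 ^ ((j - 1) * d div 2)) =
      (2 ^ (3 * j * d div 2) - 2 ^ ((3 * j - 1) * d div 2) :: real)"
  proof -
    have "j * d + j * d div 2 = 3 * j * d div 2" "j * d + (j - 1) * d div 2 = (3 * j - 1) * d div 2"
      by (simp_all add: c i algebra_simps)
    thus ?thesis by (simp add: right_diff_distrib flip: power_add)
  qed
  finally show ?thesis .
qed

text \<open>Hence the first product in the formula for \<open>A_mid\<close> at even \<open>n\<close>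
  is merely a power of two.\<close>

lemma sum_telescope_half_powers:
  "1 + (\<Sum>j=1..e. 2 ^ (j * d div 2) - 2 ^ ((j - 1) * d div 2)) = (2 ^ (e * d div 2) :: real)"
  by (induction e) simp_all

text \<open>A geometric series with ratio 8, whence the denominator 7.\<close>

lemma sum_cube_powers:
  "2 * (1 + (\<Sum>j=1..e. 2 ^ (3 * j - 1))) = ((2 ^ (3 * (e + 1)) + 6) / 7 :: real)"
proof (induction e)
  case (Suc e)
  have "3 * Suc e - 1 = 3 * e + 2" by simp
  hence "2 * (1 + (\<Sum>j=1..Suc e. 2 ^ (3 * j - 1))) =
      2 * (1 + (\<Sum>j=1..e. 2 ^ (3 * j - 1))) + 2 * (2 ^ (3 * e + 2) :: real)"
    by simp
  also have "\<dots> = (2 ^ (3 * (e + 1)) + 6) / 7 + 2 * 2 ^ (3 * e + 2)" by (simp only: Suc)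
  also have "\<dots> = (2 ^ (3 * (Suc e + 1)) + 6) / 7" by (simp add: power_add field_simps)
  finally show ?case .
qed simp

section \<open>Weight distribution in terms of the factorization\<close>

locale palindromic_code = binary_field n field + palindromic_factorization n P I R E
  for n and field :: "'a :: finite_field itself" and P I R E
begin

abbreviation code_forms :: "('a \<Rightarrow> 'a) set" where
  "code_forms \<equiv> (\<lambda>p. quad (poly_coeffs p)) ` palindromes (n - 1)"

text \<open>For a palindrome of length \<open>n - 1\<close> this is \<open>n\<close> minus the
  degree of its gcd with \<open>monom 1 n + 1\<close>, hence the codimension of the radical.\<close>

definition rank :: "bit poly \<Rightarrow> nat" where
  "rank p = (\<Sum>i\<in>I. (E i - level p i) * degree (R i))"

lemma rank_form:
  assumes p: "p \<in> palindromes (n - 1)"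
  shows "binary_quadratic_form n (quad (poly_coeffs p)) (\<lambda>x. act p x ^ 2) (rank p)"
proof -
  obtain G C H where *: "p = G * C" "monom 1 n + 1 = G * H" "coprime C H" "degree G + rank p = n"
    using palindrome_gcd_decomposition [OF p] unfolding rank_def by metis
  hence "degree G = n - rank p" "rank p \<le> n" by simp_all
  thus ?thesis using card_act_kernel_coprime [OF *(1-3)] p by (intro quad_form) simp_all
qed

lemma W_poly_code_forms:
  assumes ordering: "distinct as" "set as = (UNIV :: 'a set)"
  shows "W_poly n as code_forms = (\<Prod>i\<in>I. 1 + (\<Sum>j=1..E i.
    monom (2 ^ (3 * j * degree (R i) div 2) - 2 ^ ((3 * j - 1) * degree (R i) div 2)) (j * degree (R i))))"
proof -
  have "W_poly n as code_forms = (\<Sum>p\<in>palindromes (n - 1). monom (2 ^ rank p) (rank p))"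
    using ordering rank_form act_inject
    by (intro W_poly_quadratic_forms [where L = "\<lambda>p x. act p x ^ 2"]) auto
  \<comment> \<open>The rank is a sum over \<open>I\<close>, so the monomial splits into a product
    over \<open>I\<close>.\<close>
  also have "\<dots> = (\<Sum>p\<in>palindromes (n - 1). \<Prod>i\<in>I.
      monom (2 ^ ((E i - level p i) * degree (R i))) ((E i - level p i) * degree (R i)))"
    by (simp add: monom_prod rank_def power_sum)
  also have "\<dots> = (\<Prod>i\<in>I. monom (2 ^ (0 * degree (R i))) (0 * degree (R i)) + (\<Sum>j=1..E i.
      monom (2 ^ (j * degree (R i))) (j * degree (R i)) *
      (2 ^ (j * degree (R i) div 2) - 2 ^ ((j - 1) * degree (R i) div 2))))"
    by (rule sum_prod_palindromes [where w = "\<lambda>i j. monom (2 ^ (j * degree (R i))) (j * degree (R i))"])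
  also have "\<dots> = (\<Prod>i\<in>I. 1 + (\<Sum>j=1..E i.
    monom (2 ^ (3 * j * degree (R i) div 2) - 2 ^ ((3 * j - 1) * degree (R i) div 2)) (j * degree (R i))))"
  proof (intro prod.cong arg_cong2 [of _ _ _ _ "(+)"] sum.cong refl)
    fix i j assume "i \<in> I" "j \<in> {1..E i}"
    thus "monom (2 ^ (j * degree (R i))) (j * degree (R i)) *
      (2 ^ (j * degree (R i) div 2) - 2 ^ ((j - 1) * degree (R i) div 2)) =
      monom (2 ^ (3 * j * degree (R i) div 2) - 2 ^ ((3 * j - 1) * degree (R i) div 2) :: real)
        (j * degree (R i))"
      by (intro monom_level_weight even_deg) auto
  qed simp
  finally show ?thesis .
qed

lemma A_mid_code_forms:
  assumes ordering: "distinct as" "set as = (UNIV :: 'a set)"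
  shows "real (A_mid n as code_forms) = 2 ^ (n + 1 + n div 2) -
    2 * (\<Prod>i\<in>I. 1 + (\<Sum>j=1..E i.
      2 ^ (3 * j * degree (R i) div 2) - 2 ^ ((3 * j - 1) * degree (R i) div 2)))"
proof -
  have W: "W_poly n as code_forms = (\<Sum>p\<in>palindromes (n - 1). monom (2 ^ rank p) (rank p))"
    and A: "real (A_mid n as code_forms) = (\<Sum>p\<in>palindromes (n - 1). 2 ^ (n + 1) - 2 * 2 ^ rank p)"
    using ordering rank_form act_inject
    by (intro code_of_quadratic_forms [where L = "\<lambda>p x. act p x ^ 2"]; auto)+
  have "real (card (palindromes (n - 1))) = 2 ^ (n div 2)"
    using n_pos by (simp add: card_palindromes)
  \<comment> \<open>The sum of all \<open>2 ^ rank p\<close> is the value of \<open>W_poly\<close>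
    at 1.\<close>
  hence "real (A_mid n as code_forms) = 2 ^ (n + 1 + n div 2) - 2 * poly (W_poly n as code_forms) 1"
    unfolding A W by (simp add: poly_sum poly_monom sum_subtractf power_add sum_distrib_left)
  thus ?thesis
    unfolding W_poly_code_forms [OF ordering] by (simp add: poly_prod poly_sum poly_monom)
qed

end
theorem theorem2:
  fixes n t m l :: nat
    and r :: "nat \<Rightarrow> bit poly"
    and as :: "'a :: finite_field list"
  assumes card: "CARD('a) = 2 ^ n"
    and ordering: "distinct as" "set as = UNIV"
    and n: "n = 2 ^ t * m" "odd m"
    and factorization:
      "monom 1 n + 1 = [:1, 1:] ^ (2 ^ t) * (\<Prod>i = 1..l. r i ^ (2 ^ t))"
    and r: "\<And>i. i \<in> {1..l} \<Longrightarrow> prime_self_reciprocal (r i)"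
      "\<And>i. i \<in> {1..l} \<Longrightarrow> even (degree (r i))"
  shows
    "(even n \<longrightarrow>
        W_poly n as (C2 n) =
          (1 + (\<Sum>j = 1..2 ^ (t - 1). monom (2 ^ (3 * j - 1)) (2 * j))) *
          (\<Prod>i = 1..l. 1 + (\<Sum>j = 1..2 ^ t.
             monom (2 ^ (3 * j * degree (r i) div 2) - 2 ^ ((3 * j - 1) * degree (r i) div 2))
                   (j * degree (r i)))) \<and>
        real (A_mid n as (C2 n)) =
          2 ^ (n + 1 + 2 ^ (t - 1)) *
          (\<Prod>i = 1..l. 1 + (\<Sum>j = 1..2 ^ t.
             2 ^ (j * degree (r i) div 2) - 2 ^ ((j - 1) * degree (r i) div 2)))
          - (2 ^ (3 * (2 ^ (t - 1) + 1)) + 6) / 7 *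
          (\<Prod>i = 1..l. 1 + (\<Sum>j = 1..2 ^ t.
             2 ^ (3 * j * degree (r i) div 2) - 2 ^ ((3 * j - 1) * degree (r i) div 2)))) \<and>
     (t = 0 \<longrightarrow>
        W_poly n as (C1 n) =
          (\<Prod>i = 1..l. 1 +
             monom (2 ^ (3 * degree (r i) div 2) - 2 ^ degree (r i)) (degree (r i))) \<and>
        real (A_mid n as (C1 n)) =
          2 ^ ((3 * n + 1) div 2)
          - 2 * (\<Prod>i = 1..l. 1 + 2 ^ (3 * degree (r i) div 2) - 2 ^ degree (r i)))"
proof -
  interpret binary_field n "TYPE('a)" by standard (rule card)
  have fact_m: "monom 1 m + 1 = [:1, 1:] * (\<Prod>i=1..l. r i)"
  proof (rule bit_poly_power_2_power_inject)
    have "(monom 1 m + 1 :: bit poly) ^ 2 ^ t = monom 1 n + 1"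
      by (simp add: bit_poly_power_2_power_add monom_power n mult.commute)
    thus "(monom 1 m + 1) ^ 2 ^ t = ([:1, 1:] * (\<Prod>i=1..l. r i)) ^ 2 ^ t"
      by (simp only: factorization power_mult_distrib prod_power_distrib)
  qed
  have coprime_X1: "coprime [:1, 1:] (r i)" if i: "i \<in> {1..l}" for i
  proof (rule coprime_factors_X_power_plus_1)
    show "monom 1 m + 1 = [:1, 1:] * r i * (\<Prod>i\<in>{1..l} - {i}. r i)"
      unfolding fact_m using i by (simp only: prod.remove [of "{1..l}" i] finite_atLeastAtMost mult.assoc)
  qed (rule n)
  have coprime_r: "coprime (r i) (r j)" if ij: "i \<in> {1..l}" "j \<in> {1..l}" "i \<noteq> j" for i j
  proof (rule coprime_factors_X_power_plus_1)
    have "(\<Prod>i=1..l. r i) = r i * (r j * (\<Prod>i\<in>{1..l} - {i} - {j}. r i))"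
    proof -
      have "(\<Prod>i=1..l. r i) = r i * (\<Prod>i\<in>{1..l} - {i}. r i)"
        using ij by (intro prod.remove) auto
      also have "(\<Prod>i\<in>{1..l} - {i}. r i) = r j * (\<Prod>i\<in>{1..l} - {i} - {j}. r i)"
        using ij by (intro prod.remove) auto
      finally show ?thesis .
    qed
    thus "monom 1 m + 1 = r i * r j * ([:1, 1:] * (\<Prod>i\<in>{1..l} - {i} - {j}. r i))"
      unfolding fact_m by (simp only: mult_ac)
  qed (rule n)
  have n0: "n > 0" by (rule n_pos)
  have product_0: "(\<Prod>i=0..l. f i) = f 0 * (\<Prod>i=1..l. f i)" for f :: "nat \<Rightarrow> 'c :: comm_monoid_mult"
    by (simp add: prod.atLeast_Suc_atMost)
  show ?thesis
  proof (intro conjI impI)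
    assume even: "even n"
    have t: "t > 0" using n even by (cases t) auto
    hence pow_t: "(2 :: nat) ^ t = 2 * 2 ^ (t - 1)" by (simp flip: power_Suc)
    \<comment> \<open>The power of X + 1 is regrouped as
      \<open>([:1, 1:] ^ 2) ^ 2 ^ (t - 1)\<close>, which gives a factor of even degree; it takes the
      free index 0.\<close>
    define R where "R = r(0 := [:1, 1:] ^ 2)"
    define E where "E = (\<lambda>i::nat. if i = 0 then 2 ^ (t - 1) else 2 ^ t :: nat)"
    have R_0: "R 0 = [:1, 1:] ^ 2" and R_i: "\<And>i. i \<in> {1..l} \<Longrightarrow> R i = r i"
      and E_0: "E 0 = 2 ^ (t - 1)" and E_i: "\<And>i. i \<in> {1..l} \<Longrightarrow> E i = 2 ^ t"
      by (auto simp: R_def E_def)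
    have degree_R_0: "degree (R 0) = 2" unfolding R_0 by (simp add: degree_power_eq)
    have cases_0: "i = 0 \<or> i \<in> {1..l}" if "i \<in> {0..l}" for i using that by auto
    have coprime_R_0: "coprime (R 0) (R i)" if "i \<in> {1..l}" for i
      using coprime_X1 [OF that] by (simp only: R_0 R_i [OF that] coprime_power_left_iff) simp
    interpret palindromic_code n "TYPE('a)" 1 "{0..l}" R E
    proof
      show "monom 1 n + 1 = 1 * (\<Prod>i=0..l. R i ^ E i)"
        unfolding factorization product_0 by (simp add: R_0 E_0 R_i E_i pow_t flip: power_mult)
      show "self_reciprocal (R i)" if "i \<in> {0..l}" for i
        using cases_0 [OF that] r(1)
        by (auto simp only: R_0 R_i self_reciprocal_X_plus_1 self_reciprocal_power
            prime_self_reciprocal_imp_self_reciprocal)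
      show "even (degree (R i))" if "i \<in> {0..l}" for i
        using cases_0 [OF that] r(2) by (auto simp: degree_R_0 R_i)
      show "coprime (R i) (R j)" if ij: "i \<in> {0..l}" "j \<in> {0..l}" "i \<noteq> j" for i j
      proof -
        consider "i = 0" "j \<in> {1..l}" | "j = 0" "i \<in> {1..l}" | "i \<in> {1..l}" "j \<in> {1..l}"
          using ij(3) cases_0 [OF ij(1)] cases_0 [OF ij(2)] by blast
        thus ?thesis
          using coprime_R_0 coprime_r ij(3) by cases (simp_all add: R_i coprime_commute)
      qed
      show "coprime (R i) p"
        if "i \<in> {0..l}" "p \<in> palindromes N" "even N = even (n - 1)" "\<not> R i dvd p" for i N p
        using cases_0 [OF that(1)]
      proof
        assume "i = 0"
        moreover have "odd N" using that(3) even n0 by simp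
        ultimately show ?thesis
          using that(2,4) X_plus_1_square_coprime_palindrome by (simp only: R_0)
      next
        assume i: "i \<in> {1..l}"
        show ?thesis
          using that(2,4) r(1) [OF i] prime_self_reciprocal_coprime_palindrome by (simp only: R_i [OF i])
      qed
    qed (use n0 in simp_all)
    have C2: "C2 n = code_forms" by (simp only: C2_eq_quad [OF even] quad_image)
    \<comment> \<open>As \<open>R 0\<close> has degree 2, the coefficient is
      \<open>2 ^ (3 * j) - 2 ^ (3 * j - 1) = 2 ^ (3 * j - 1)\<close>.\<close>
    have first_W: "1 + (\<Sum>j=1..E 0. monom (2 ^ (3 * j * degree (R 0) div 2) -
        2 ^ ((3 * j - 1) * degree (R 0) div 2)) (j * degree (R 0))) =
      1 + (\<Sum>j=1..2 ^ (t - 1). monom (2 ^ (3 * j - 1) :: real) (2 * j))"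
    proof (intro arg_cong2 [of _ _ _ _ "(+)"] sum.cong)
      fix j :: nat assume "j \<in> {1..2 ^ (t - 1)}"
      then obtain i where "j = Suc i" by (cases j) auto
      thus "monom (2 ^ (3 * j * degree (R 0) div 2) - 2 ^ ((3 * j - 1) * degree (R 0) div 2))
          (j * degree (R 0)) = monom (2 ^ (3 * j - 1) :: real) (2 * j)"
        by (simp add: degree_R_0 power_add mult.commute [of i 2])
    qed (simp_all add: E_0)
    show W: "W_poly n as (C2 n) =
          (1 + (\<Sum>j = 1..2 ^ (t - 1). monom (2 ^ (3 * j - 1)) (2 * j))) *
          (\<Prod>i = 1..l. 1 + (\<Sum>j = 1..2 ^ t.
             monom (2 ^ (3 * j * degree (r i) div 2) - 2 ^ ((3 * j - 1) * degree (r i) div 2))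
                   (j * degree (r i))))"
      unfolding C2 W_poly_code_forms [OF ordering] product_0 first_W
      by (intro arg_cong2 [of _ _ _ _ "(*)"] prod.cong refl) (simp only: R_i E_i)
    have first_A: "1 + (\<Sum>j=1..E 0. 2 ^ (3 * j * degree (R 0) div 2) -
        2 ^ ((3 * j - 1) * degree (R 0) div 2)) = (1 + (\<Sum>j=1..2 ^ (t - 1). 2 ^ (3 * j - 1)) :: real)"
      using arg_cong [OF first_W, of "\<lambda>p. poly p 1"] by (simp add: poly_sum poly_monom)
    define B :: real where "B = (\<Prod>i = 1..l. 1 + (\<Sum>j = 1..2 ^ t.
             2 ^ (3 * j * degree (r i) div 2) - 2 ^ ((3 * j - 1) * degree (r i) div 2)))"
    have B: "(\<Prod>i = 1..l. 1 + (\<Sum>j = 1..E i.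
             2 ^ (3 * j * degree (R i) div 2) - 2 ^ ((3 * j - 1) * degree (R i) div 2))) = B"
      unfolding B_def by (intro prod.cong refl) (simp only: R_i E_i)
    have A: "real (A_mid n as (C2 n)) = 2 ^ (n + 1 + n div 2) -
        2 * (1 + (\<Sum>j=1..2 ^ (t - 1). 2 ^ (3 * j - 1))) * B"
      unfolding C2 A_mid_code_forms [OF ordering] product_0 first_A B by (simp only: mult.assoc)
    \<comment> \<open>All degrees are even, so the degree count for the factorization can be halved
      term by term.\<close>
    have half_n: "n div 2 = 2 ^ (t - 1) + (\<Sum>i=1..l. 2 ^ t * degree (r i) div 2)"
    proof -
      have "n = E 0 * degree (R 0) + (\<Sum>i=1..l. E i * degree (R i))"
        using degree_fact by (simp add: sum.atLeast_Suc_atMost)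
      also have "(\<Sum>i=1..l. E i * degree (R i)) = (\<Sum>i=1..l. 2 * (2 ^ t * degree (r i) div 2))"
        using r(2) by (intro sum.cong refl) (simp add: R_i E_i)
      finally show ?thesis by (simp add: E_0 degree_R_0 flip: sum_distrib_left)
    qed
    have "2 ^ (n + 1 + n div 2) = (2 ^ (n + 1 + 2 ^ (t - 1)) *
          (\<Prod>i = 1..l. 1 + (\<Sum>j = 1..2 ^ t.
             2 ^ (j * degree (r i) div 2) - 2 ^ ((j - 1) * degree (r i) div 2))) :: real)"
      unfolding sum_telescope_half_powers half_n by (simp add: power_add power_sum)
    thus "real (A_mid n as (C2 n)) =
          2 ^ (n + 1 + 2 ^ (t - 1)) *
          (\<Prod>i = 1..l. 1 + (\<Sum>j = 1..2 ^ t.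
             2 ^ (j * degree (r i) div 2) - 2 ^ ((j - 1) * degree (r i) div 2)))
          - (2 ^ (3 * (2 ^ (t - 1) + 1)) + 6) / 7 *
          (\<Prod>i = 1..l. 1 + (\<Sum>j = 1..2 ^ t.
             2 ^ (3 * j * degree (r i) div 2) - 2 ^ ((3 * j - 1) * degree (r i) div 2)))"
      unfolding A sum_cube_powers B_def by (simp only:)
  next
    assume t: "t = 0"
    hence odd: "odd n" using n by simp
    \<comment> \<open>Now \<open>n - 1\<close> is even, so X + 1 divides every palindrome concerned
      and is split off as \<open>P\<close>; all other factors are simple.\<close>
    interpret palindromic_code n "TYPE('a)" "[:1, 1:]" "{1..l}" r "\<lambda>_. 1"
    proof
      show "monom 1 n + 1 = [:1, 1:] * (\<Prod>i=1..l. r i ^ 1)"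
        using factorization by (simp add: t)
      show "[:1, 1:] dvd p" if "p \<in> palindromes (n - 1)" for p
        using that odd by (intro X_plus_1_dvd_palindrome) auto
      show "coprime (r i) p"
        if "i \<in> {1..l}" "p \<in> palindromes N" "even N = even (n - 1)" "\<not> r i dvd p" for i N p
        using that r(1) prime_self_reciprocal_coprime_palindrome by blast
    qed (use n0 r coprime_r coprime_X1 prime_self_reciprocal_imp_self_reciprocal in auto)
    have C1: "C1 n = code_forms" by (simp only: C1_eq_quad [OF odd] quad_image)
    show W: "W_poly n as (C1 n) =
          (\<Prod>i = 1..l. 1 +
             monom (2 ^ (3 * degree (r i) div 2) - 2 ^ degree (r i)) (degree (r i)))"
      unfolding C1 W_poly_code_forms [OF ordering] by simp
    have "n + 1 + n div 2 = (3 * n + 1) div 2" using odd by presburger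
    thus "real (A_mid n as (C1 n)) =
          2 ^ ((3 * n + 1) div 2)
          - 2 * (\<Prod>i = 1..l. 1 + 2 ^ (3 * degree (r i) div 2) - 2 ^ degree (r i))"
      unfolding C1 A_mid_code_forms [OF ordering] by (simp add: algebra_simps)
  qed
qed

end
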